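(* Every (finitely generated) polycyclic group $G$ is bounded, i.e. $1\le s(G)<\infty$, where $s(G)$ is the iterational depth of $G$.
   Context: Let $w=w(x_1,\dots,x_n)$ be a word (element of the free group $F_n$ on $x_1,\dots,x_n$, $n\ge 1$). Its Engel type iterations on the first variable are $w_{\circ 1}=w$ and $w_{\circ (N+1)}(x_1,\dots,x_n)=w(w_{\circ N}(x_1,\dots,x_n),x_2,\dots,x_n)$ for $N\ge 1$. A group $G$ satisfies the ($E$-type) iterated identity $w$ if for all $x_1,\dots,x_n\in G$ there exists $N\ge 1$ with $w_{\circ N}(x_1,\dots,x_n)=e$ in $G$. If $w$ is an iterated identity of $G$, the iterational depth $s(w,G)$ of $w$ in $G$ is the infimum (possibly $+\infty$) of those integers $D\ge 1$ such that for all $x_1,\dots,x_n\in G$ there is $1\le d\le D$ with $w_{\circ d}(x_1,\dots,x_n)=e$. A word is non-trivial if it is not equal to the identity in the free group. The iterational depth of $G$ is $s(G)=\sup_w s(w,G)$, the supremum over all non-trivial iterated identities $w$ (in any number of variables) satisfied by $G$; if $G$ satisfies no non-trivial iterated identity, $s(G)=-\infty$. $G$ is called bounded if $1\le s(G)<\infty$. *)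

theory Defs
  imports "HOL-Algebra.Elementary_Groups" "HOL-Algebra.Coset" "HOL-Library.Extended_Real"
begin

section \<open>Free groups of finite rank\<close>

text \<open>
  The letter \<open>(i, True)\<close> is the generator of index \<open>i\<close> and \<open>(i, False)\<close> is its formal inverse.
  Indices start at \<open>0\<close>, so the generators \<open>x\<^sub>1, \<dots>, x\<^sub>n\<close> of \<open>F\<^sub>n\<close> have the indices
  \<open>0, \<dots>, n - 1\<close>.  The elements of \<open>F\<^sub>n\<close> are the reduced words; the product is concatenation
  followed by free reduction.
\<close>

type_synonym letter = "nat \<times> bool"
type_synonym word = "letter list"

definition inv_letter :: "letter \<Rightarrow> letter" where
  "inv_letter a = (fst a, \<not> snd a)"

definition reduced :: "word \<Rightarrow> bool" where
  "reduced = successively (\<lambda>a b. b \<noteq> inv_letter a)"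

fun cons_letter :: "letter \<Rightarrow> word \<Rightarrow> word" where
  "cons_letter a [] = [a]"
| "cons_letter a (b # u) = (if b = inv_letter a then u else a # b # u)"

definition free_group :: "nat \<Rightarrow> word monoid" where
  "free_group n =
     \<lparr>carrier = {w. set w \<subseteq> {..<n} \<times> UNIV \<and> reduced w},
      mult = (\<lambda>u v. foldr cons_letter u v),
      one = []\<rparr>"

definition gen :: "nat \<Rightarrow> word" where
  "gen i = [(i, True)]"

lemma inv_letter_inv_letter [simp]: "inv_letter (inv_letter a) = a"
  by (simp add: inv_letter_def)

lemma reduced_Nil [simp]: "reduced []"
  by (simp add: reduced_def)

lemma reduced_Cons: "reduced (a # w) \<longleftrightarrow> w = [] \<or> hd w \<noteq> inv_letter a \<and> reduced w"
  by (auto simp: reduced_def successively_Cons)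

lemma reduced_ConsD: "reduced (a # w) \<Longrightarrow> reduced w"
  by (auto simp: reduced_Cons)

lemma reduced_cons_letter: "reduced w \<Longrightarrow> reduced (cons_letter a w)"
  by (cases w) (auto simp: reduced_Cons)

lemma reduced_foldr: "reduced v \<Longrightarrow> reduced (foldr cons_letter u v)"
  by (induction u) (auto intro: reduced_cons_letter)

lemma set_cons_letter: "set (cons_letter a w) \<subseteq> insert a (set w)"
  by (cases w) auto

lemma set_foldr: "set (foldr cons_letter u v) \<subseteq> set u \<union> set v"
  by (induction u) (use set_cons_letter in fastforce)+

lemma cons_letter_cancel: "reduced w \<Longrightarrow> cons_letter a (cons_letter (inv_letter a) w) = w"
  by (cases w; cases "tl w") (auto simp: reduced_Cons)

lemma foldr_cons_letter:
  "reduced w \<Longrightarrow> foldr cons_letter (cons_letter a t) w = cons_letter a (foldr cons_letter t w)"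
  by (cases t) (auto simp: cons_letter_cancel reduced_foldr)

lemma foldr_cons_letter_assoc:
  "reduced w \<Longrightarrow>
    foldr cons_letter (foldr cons_letter u v) w = foldr cons_letter u (foldr cons_letter v w)"
  by (induction u) (auto simp: foldr_cons_letter)

lemma foldr_cons_letter_Nil: "reduced u \<Longrightarrow> foldr cons_letter u [] = u"
proof (induction u)
  case (Cons a u)
  then show ?case by (cases u) (auto simp: reduced_Cons)
qed simp

lemma foldr_rev_inv: "reduced v \<Longrightarrow> foldr cons_letter (map inv_letter (rev u)) (foldr cons_letter u v) = v"
proof (induction u arbitrary: v)
  case (Cons a u)
  then show ?case
    using cons_letter_cancel[of "foldr cons_letter u v" "inv_letter a"] by (simp add: reduced_foldr)
qed simp

lemma reduced_rev_inv: "reduced (map inv_letter (rev u)) \<longleftrightarrow> reduced u"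
proof -
  have "successively (\<lambda>a b. inv_letter a \<noteq> b) u = successively (\<lambda>a b. b \<noteq> inv_letter a) u"
    by (intro successively_cong) auto
  then show ?thesis
    by (simp add: reduced_def successively_map rev_map[symmetric])
qed

lemma group_free_group: "group (free_group n)"
proof (rule groupI)
  fix u assume u: "u \<in> carrier (free_group n)"
  show "\<exists>v\<in>carrier (free_group n). v \<otimes>\<^bsub>free_group n\<^esub> u = \<one>\<^bsub>free_group n\<^esub>"
  proof (rule bexI[where x = "map inv_letter (rev u)"])
    show "map inv_letter (rev u) \<otimes>\<^bsub>free_group n\<^esub> u = \<one>\<^bsub>free_group n\<^esub>"
      using u foldr_rev_inv[of "[]" u] by (simp add: free_group_def foldr_cons_letter_Nil)
    show "map inv_letter (rev u) \<in> carrier (free_group n)"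
      using u reduced_rev_inv[of u] by (auto simp: free_group_def inv_letter_def)
  qed
next
  fix u v assume "u \<in> carrier (free_group n)" "v \<in> carrier (free_group n)"
  then show "u \<otimes>\<^bsub>free_group n\<^esub> v \<in> carrier (free_group n)"
    using set_foldr[of u v] by (auto simp: free_group_def reduced_foldr)
qed (auto simp: free_group_def foldr_cons_letter_assoc)


section \<open>Iterated identities\<close>

text \<open>
  \<open>word_eval G x w\<close> is the image of \<open>w\<close> under the homomorphism from the free group to \<open>G\<close> sending
  the generator of index \<open>i\<close> to \<open>x i\<close>.  For \<open>G = free_group n\<close> it is substitution of words.
\<close>

definition word_eval :: "('a, 'b) monoid_scheme \<Rightarrow> (nat \<Rightarrow> 'a) \<Rightarrow> word \<Rightarrow> 'a" where
  "word_eval G x w =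
     foldr (\<lambda>a g. (if snd a then x (fst a) else inv\<^bsub>G\<^esub> (x (fst a))) \<otimes>\<^bsub>G\<^esub> g) w \<one>\<^bsub>G\<^esub>"

context group
begin

lemma word_eval_Nil [simp]: "word_eval G x [] = \<one>"
  by (simp add: word_eval_def)

lemma word_eval_Cons:
  "word_eval G x (a # w) = (if snd a then x (fst a) else inv (x (fst a))) \<otimes> word_eval G x w"
  by (simp add: word_eval_def)

lemma word_eval_closed:
  assumes "x \<in> {..<n} \<rightarrow> carrier G" "set w \<subseteq> {..<n} \<times> UNIV"
  shows "word_eval G x w \<in> carrier G"
  using assms(2) by (induction w) (use assms(1) in \<open>auto simp: word_eval_Cons Pi_iff\<close>)

lemma word_eval_cons_letter:
  assumes "x \<in> {..<n} \<rightarrow> carrier G" "set (a # w) \<subseteq> {..<n} \<times> UNIV"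
  shows "word_eval G x (cons_letter a w) = word_eval G x (a # w)"
proof (cases w)
  case (Cons b u)
  have "x (fst a) \<in> carrier G" "word_eval G x u \<in> carrier G"
    using assms Cons by (auto intro: word_eval_closed)
  then show ?thesis
    using Cons by (auto simp: word_eval_Cons inv_letter_def m_assoc[symmetric])
qed (use assms in simp)

lemma word_eval_foldr:
  assumes x: "x \<in> {..<n} \<rightarrow> carrier G"
    and "set u \<subseteq> {..<n} \<times> UNIV" and v: "set v \<subseteq> {..<n} \<times> UNIV"
  shows "word_eval G x (foldr cons_letter u v) = word_eval G x u \<otimes> word_eval G x v"
  using assms(2)
proof (induction u)
  case Nil
  then show ?case using word_eval_closed[OF x v] by simp
next
  case (Cons a u)
  have "set (a # foldr cons_letter u v) \<subseteq> {..<n} \<times> UNIV"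
    using Cons.prems v set_foldr[of u v] by auto
  moreover have "x (fst a) \<in> carrier G" "word_eval G x u \<in> carrier G"
    using Cons.prems x by (auto intro: word_eval_closed)
  ultimately show ?case
    using Cons word_eval_closed[OF x v] x
    by (auto simp: word_eval_cons_letter word_eval_Cons m_assoc)
qed

lemma word_eval_hom:
  assumes "x \<in> {..<n} \<rightarrow> carrier G"
  shows "word_eval G x \<in> hom (free_group n) G"
  using word_eval_closed[OF assms] word_eval_foldr[OF assms]
  by (auto intro!: homI simp: free_group_def)

lemma word_eval_gen:
  assumes "x i \<in> carrier G"
  shows "word_eval G x (gen i) = x i"
  using assms by (simp add: gen_def word_eval_Cons)

end

definition engel_iter :: "nat \<Rightarrow> word \<Rightarrow> nat \<Rightarrow> word" where
  \<comment> \<open>\<open>w\<^sub>\<circ>\<^sub>N\<close> for \<open>N \<ge> 1\<close>, as an element of \<open>F\<^sub>n\<close>; the value at \<open>N = 0\<close> is not meaningful\<close>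
  "engel_iter n w N = ((\<lambda>u. word_eval (free_group n) (gen(0 := u)) w) ^^ (N - 1)) w"

lemma engel_iter_1: "engel_iter n w 1 = w"
  by (simp add: engel_iter_def)

lemma engel_iter_Suc:
  assumes "N \<ge> 1"
  shows "engel_iter n w (Suc N) = word_eval (free_group n) (gen(0 := engel_iter n w N)) w"
  using assms by (cases N) (simp_all add: engel_iter_def)

definition iterated_identity :: "('a, 'b) monoid_scheme \<Rightarrow> nat \<Rightarrow> word \<Rightarrow> bool" where
  "iterated_identity G n w \<longleftrightarrow>
     (\<forall>x \<in> {..<n} \<rightarrow> carrier G. \<exists>N\<ge>1. word_eval G x (engel_iter n w N) = \<one>\<^bsub>G\<^esub>)"

definition word_depth :: "('a, 'b) monoid_scheme \<Rightarrow> nat \<Rightarrow> word \<Rightarrow> ereal" where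
  "word_depth G n w =
     Inf {ereal (real D) |D. D \<ge> 1 \<and>
       (\<forall>x \<in> {..<n} \<rightarrow> carrier G. \<exists>d. 1 \<le> d \<and> d \<le> D \<and> word_eval G x (engel_iter n w d) = \<one>\<^bsub>G\<^esub>)}"

text \<open>In \<^typ>\<open>ereal\<close> the infimum of the empty set is \<open>\<infinity>\<close> and its supremum is \<open>-\<infinity>\<close>.\<close>

definition iterational_depth :: "('a, 'b) monoid_scheme \<Rightarrow> ereal" where
  "iterational_depth G =
     Sup {word_depth G n w |n w. n \<ge> 1 \<and> w \<in> carrier (free_group n) \<and>
       w \<noteq> \<one>\<^bsub>free_group n\<^esub> \<and> iterated_identity G n w}"

definition bounded_group :: "('a, 'b) monoid_scheme \<Rightarrow> bool" where
  "bounded_group G \<longleftrightarrow> 1 \<le> iterational_depth G \<and> iterational_depth G < \<infinity>"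


section \<open>Polycyclic groups\<close>

definition polycyclic :: "('a, 'b) monoid_scheme \<Rightarrow> bool" where
  "polycyclic G \<longleftrightarrow>
     (\<exists>(H :: nat \<Rightarrow> 'a set) k. H 0 = carrier G \<and> H k = {\<one>\<^bsub>G\<^esub>} \<and>
       (\<forall>i<k. H (Suc i) \<lhd> (G\<lparr>carrier := H i\<rparr>) \<and>
              cyclic_group ((G\<lparr>carrier := H i\<rparr>) Mod H (Suc i))))"

end

theory Submission
  imports Defs
begin

text \<open>
  Fixing \<open>x\<^sub>2, \<dots>, x\<^sub>n\<close> turns a word into a polynomial map \<open>f\<close> of \<open>G\<close>, and it suffices to bound the first
  hitting time of \<open>\<one>\<close> uniformly over all polynomial maps \<open>f\<close> whose orbits all hit \<open>\<one>\<close>.  We descend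
  along the normal series obtained from the derived series by inserting the torsion of each abelian
  factor.  If every orbit enters \<open>N\<close> within \<open>D\<close> steps, then some \<open>f\<^sup>p\<close> with \<open>p \<le> D\<close> maps \<open>N\<close> to itself
  modulo \<open>M\<close>, and one has to bound its hitting times on \<open>N/M\<close>.  For finite \<open>N/M\<close> this is the
  pigeonhole principle.  If \<open>N/M\<close> is abelian and torsion-free, then \<open>f\<^sup>p\<close> acts as an affine map
  \<open>a \<mapsto> \<phi>(a) c\<close>; since all orbits hit \<open>\<one>\<close>, the endomorphism \<open>\<phi>\<close> is nilpotent, of degree at most the
  rank, hence an iterate of bounded order is constantly \<open>\<one>\<close>.
\<close>

section \<open>Affine maps of abelian groups with a cyclic series\<close>

definition torsion_free :: "('a, 'b) monoid_scheme \<Rightarrow> bool" where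
  "torsion_free G \<longleftrightarrow> (\<forall>a\<in>carrier G. \<forall>m::int. m \<noteq> 0 \<longrightarrow> a [^]\<^bsub>G\<^esub> m = \<one>\<^bsub>G\<^esub> \<longrightarrow> a = \<one>\<^bsub>G\<^esub>)"

text \<open>Cyclicity of the factors is stated through elements, \<open>x\<close> being a power of
  \<open>g\<close> modulo \<open>H (Suc i)\<close>; in this form it passes to homomorphic images
  without any handling of quotients.\<close>

definition cyclic_series :: "('a, 'b) monoid_scheme \<Rightarrow> (nat \<Rightarrow> 'a set) \<Rightarrow> nat \<Rightarrow> bool" where
  "cyclic_series G H k \<longleftrightarrow> H 0 = carrier G \<and> H k = {\<one>\<^bsub>G\<^esub>} \<and> (\<forall>i\<le>k. subgroup (H i) G) \<and>
     (\<forall>i<k. \<exists>g\<in>H i. \<forall>x\<in>H i. \<exists>s::int. x \<otimes>\<^bsub>G\<^esub> g [^]\<^bsub>G\<^esub> s \<in> H (Suc i))"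

lemma cyclic_series_gen:
  assumes "cyclic_series G H k" "i < k"
  obtains g where "g \<in> H i" "\<And>x. x \<in> H i \<Longrightarrow> \<exists>s::int. x \<otimes>\<^bsub>G\<^esub> g [^]\<^bsub>G\<^esub> s \<in> H (Suc i)"
  using assms by (auto simp: cyclic_series_def)

lemma funpow_in_carrier: "f \<in> A \<rightarrow> A \<Longrightarrow> a \<in> A \<Longrightarrow> (f ^^ n) a \<in> A"
  by (induction n) auto

lemma (in group) hom_funpow:
  assumes "\<phi> \<in> hom G G"
  shows "\<phi> ^^ n \<in> hom G G"
proof (induction n)
  case (Suc n)
  then show ?case using assms by (simp add: hom_def Pi_iff)
qed (simp add: hom_def)

section \<open>Rank argument for endomorphisms and affine maps\<close>

context comm_group
begin

text \<open>Modulo \<open>H (Suc i)\<close> both elements are powers of one \<open>g\<close>, with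
  exponents \<open>- a\<close> and \<open>- b\<close> say, so \<open>x [^] b\<close> and
  \<open>y [^] a\<close> agree there.\<close>

lemma cyclic_series_dependent:
  assumes "cyclic_series G H k" "i < k" "x \<in> H i" "y \<in> H i"
  obtains s t :: int where "(s, t) \<noteq> (0, 0)" "x [^] s \<otimes> y [^] t \<in> H (Suc i)"
proof -
  have sub: "subgroup (H i) G" "subgroup (H (Suc i)) G"
    using assms by (auto simp: cyclic_series_def)
  obtain g where g: "g \<in> H i" "\<And>x. x \<in> H i \<Longrightarrow> \<exists>s::int. x \<otimes> g [^] s \<in> H (Suc i)"
    using cyclic_series_gen[OF assms(1,2)] by blast
  obtain a b :: int where ab: "x \<otimes> g [^] a \<in> H (Suc i)" "y \<otimes> g [^] b \<in> H (Suc i)"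
    using g assms by blast
  have c [simp]: "x \<in> carrier G" "y \<in> carrier G" "g \<in> carrier G"
    using sub g assms by (auto dest: subgroup.mem_carrier)
  \<comment> \<open>With both exponents zero this relation is empty, but then \<open>x\<close>
    itself lies in \<open>H (Suc i)\<close>.\<close>
  show ?thesis
  proof (cases "(b, - a) = (0, 0)")
    case True
    then have "x [^] (1::int) \<otimes> y [^] (0::int) \<in> H (Suc i)" using ab by simp
    then show ?thesis using that[of 1 0] by simp
  next
    case False
    have "(x \<otimes> g [^] a) [^] b \<otimes> (y \<otimes> g [^] b) [^] (- a) \<in> H (Suc i)"
      by (intro subgroup.m_closed[OF sub(2)] subgroup_int_pow_closed[OF sub(2)] ab)
    also have "(x \<otimes> g [^] a) [^] b \<otimes> (y \<otimes> g [^] b) [^] (- a) =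
        x [^] b \<otimes> y [^] (- a) \<otimes> (g [^] (a * b) \<otimes> g [^] (b * - a))"
      by (simp add: int_pow_distrib int_pow_pow m_ac)
    also have "g [^] (a * b) \<otimes> g [^] (b * - a) = \<one>"
      by (simp flip: int_pow_mult)
    finally have "x [^] b \<otimes> y [^] (- a) \<in> H (Suc i)" by simp
    then show ?thesis by (rule that[OF False])
  qed
qed

text \<open>The indices of the infinite factors that \<open>K\<close> meets; their number plays the role of the rank of \<open>K\<close>.\<close>

definition visible :: "(nat \<Rightarrow> 'a set) \<Rightarrow> nat \<Rightarrow> 'a set \<Rightarrow> nat set" where
  "visible H k K = {i. i < k \<and> (\<exists>x\<in>K \<inter> H i. \<forall>t::int. t \<noteq> 0 \<longrightarrow> x [^] t \<notin> H (Suc i))}"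

lemma visible_mono: "K \<subseteq> L \<Longrightarrow> visible H k K \<subseteq> visible H k L"
  by (auto simp: visible_def)

text \<open>A rank argument, by descending induction along the series. If no nonzero power of
  \<open>x\<close> lies in the next term, the index is visible in \<open>L\<close>, hence in
  \<open>K\<close>, and some element of \<open>K\<close> is dependent on \<open>x\<close> modulo the
  next term.\<close>

lemma power_mem_of_visible_eq:
  assumes ser: "cyclic_series G H k" and K: "subgroup K G" and L: "subgroup L G"
    and KL: "K \<subseteq> L" "visible H k K = visible H k L" and x: "x \<in> L"
  shows "\<exists>m::int. m \<noteq> 0 \<and> x [^] m \<in> K"
proof -
  have "\<exists>m::int. m \<noteq> 0 \<and> x [^] m \<in> K" if "i \<le> k" "x \<in> L \<inter> H i" for i x
    using that
  proof (induction i arbitrary: x rule: inc_induct)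
    case base
    then have "x [^] (1::int) \<in> K"
      using ser subgroup.one_closed[OF K] by (auto simp: cyclic_series_def)
    then show ?case by (intro exI[of _ 1]) simp
  next
    case (step i)
    have subi: "subgroup (H i) G" "subgroup (H (Suc i)) G"
      using ser step.hyps by (auto simp: cyclic_series_def)
    have xc: "x \<in> carrier G" using step.prems subgroup.mem_carrier[OF L] by simp
    \<comment> \<open>Once \<open>x [^] s\<close> lies in the next term up to a factor
      \<open>z\<close> from \<open>K\<close>, the induction hypothesis puts a power of
      \<open>x [^] s \<otimes> z\<close> into \<open>K\<close>, and the power of \<open>z\<close>
      can be removed.\<close>
    have aux: ?case if s: "s \<noteq> 0" "z \<in> K" "x [^] s \<otimes> z \<in> H (Suc i)" for s :: int and z
    proof -
      have zc: "z \<in> carrier G" using s subgroup.mem_carrier[OF K] by simp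
      have "x [^] s \<otimes> z \<in> L"
        using step.prems s KL L by (intro subgroup.m_closed subgroup_int_pow_closed) auto
      then obtain m :: int where m: "m \<noteq> 0" "(x [^] s \<otimes> z) [^] m \<in> K"
        using step.IH s by blast
      have "(x [^] s \<otimes> z) [^] m \<otimes> z [^] (- m) \<in> K"
        using m s K by (intro subgroup.m_closed[OF K] m subgroup_int_pow_closed) auto
      also have "(x [^] s \<otimes> z) [^] m \<otimes> z [^] (- m) = x [^] (s * m) \<otimes> (z [^] m \<otimes> z [^] (- m))"
        using xc zc by (simp add: int_pow_distrib int_pow_pow m_assoc)
      also have "z [^] m \<otimes> z [^] (- m) = \<one>"
        using zc by (simp flip: int_pow_mult)
      finally show ?case using xc m s by (intro exI[of _ "s * m"]) simp
    qed
    show ?case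
    proof (cases "\<exists>s::int. s \<noteq> 0 \<and> x [^] s \<in> H (Suc i)")
      case True
      then show ?thesis using aux[of _ \<one>] xc subgroup.one_closed[OF K] by auto
    next
      case False
      then have "i \<in> visible H k L" using step by (auto simp: visible_def)
      then obtain y where y: "y \<in> K \<inter> H i" "\<And>t::int. t \<noteq> 0 \<Longrightarrow> y [^] t \<notin> H (Suc i)"
        using KL(2) unfolding visible_def by blast
      obtain s t :: int where st: "(s, t) \<noteq> (0, 0)" "x [^] s \<otimes> y [^] t \<in> H (Suc i)"
        using cyclic_series_dependent[OF ser step.hyps(2), of x y] step.prems y(1) by auto
      have "y \<in> carrier G" using y(1) subgroup.mem_carrier[OF K] by simp
      \<comment> \<open>If \<open>s = 0\<close>, the relation would put a nonzero power of
        \<open>y\<close> into \<open>H (Suc i)\<close>.\<close>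
      then have "s \<noteq> 0" using st y by (cases "t = 0") auto
      moreover have "y [^] t \<in> K" using y(1) subgroup_int_pow_closed[OF K] by simp
      ultimately show ?thesis using aux st by blast
    qed
  qed
  from this[of 0] show ?thesis
    using x ser subgroup.subset[OF L] by (auto simp: cyclic_series_def)
qed

text \<open>The kernels of the powers of \<open>\<phi>\<close> ascend and their visible index sets
  lie in \<open>{..<k}\<close>, so these sets fail to grow at some \<open>j \<le> k\<close>. The
  next kernel is then torsion over the \<open>j\<close>-th one, torsion-freeness makes the two
  equal, and the chain is constant from there on.\<close>

lemma nil_endomorphism:
  assumes ser: "cyclic_series G H k" and tf: "torsion_free G" and \<phi>: "\<phi> \<in> hom G G"
    and nil: "\<And>a. a \<in> carrier G \<Longrightarrow> \<exists>j. (\<phi> ^^ j) a = \<one>" and a: "a \<in> carrier G"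
  shows "(\<phi> ^^ k) a = \<one>"
proof -
  define K where "K j = {a \<in> carrier G. (\<phi> ^^ j) a = \<one>}" for j
  have hom: "group_hom G G (\<phi> ^^ j)" for j
    using hom_funpow[OF \<phi>] by (simp add: group_hom_def group_hom_axioms_def is_group)
  have \<phi>1: "\<phi> \<one> = \<one>" using hom[of 1] group_hom.hom_one by fastforce
  have subK: "subgroup (K j) G" for j
    using group_hom.subgroup_kernel[OF hom] by (simp add: K_def kernel_def)
  have "K j \<subseteq> K (Suc j)" for j using \<phi>1 by (auto simp: K_def)
  then have mono: "K i \<subseteq> K j" if "i \<le> j" for i j using that by (rule lift_Suc_mono_le)
  have stat: "K (Suc j) \<subseteq> K j" if eq: "visible H k (K j) = visible H k (K (Suc j))" for j
  proof
    fix x assume x: "x \<in> K (Suc j)"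
    then have xc: "x \<in> carrier G" by (simp add: K_def)
    interpret h: group_hom G G "\<phi> ^^ j" by (rule hom)
    obtain m :: int where m: "m \<noteq> 0" "x [^] m \<in> K j"
      using power_mem_of_visible_eq[OF ser subK subK mono eq x] by auto
    then have "((\<phi> ^^ j) x) [^] m = \<one>"
      using h.hom_int_pow[OF xc] by (simp add: K_def)
    then show "x \<in> K j"
      using tf m xc unfolding torsion_free_def K_def by auto
  qed
  \<comment> \<open>Otherwise \<open>k + 1\<close> strict inclusions would produce more than
    \<open>k\<close> visible indices.\<close>
  have "\<exists>j\<le>k. visible H k (K j) = visible H k (K (Suc j))"
  proof (rule ccontr)
    assume neg: "\<not> ?thesis"
    have fin: "finite (visible H k L)" for L by (simp add: visible_def)
    have "j \<le> card (visible H k (K j))" if "j \<le> Suc k" for j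
      using that
    proof (induction j)
      case (Suc j)
      have "visible H k (K j) \<subset> visible H k (K (Suc j))"
      proof
        show "visible H k (K j) \<subseteq> visible H k (K (Suc j))"
          by (intro visible_mono mono) simp
        show "visible H k (K j) \<noteq> visible H k (K (Suc j))"
          using neg Suc.prems by (meson Suc_le_mono)
      qed
      from psubset_card_mono[OF fin this] show ?case using Suc by simp
    qed simp
    from this[of "Suc k"] have "Suc k \<le> card (visible H k (K (Suc k)))" by simp
    also have "\<dots> \<le> card {..<k}" by (intro card_mono) (auto simp: visible_def)
    finally show False by simp
  qed
  then obtain j where j: "j \<le> k" "K (Suc j) \<subseteq> K j" using stat by blast
  \<comment> \<open>One equality propagates: \<open>\<phi> x \<in> K i \<subseteq> K j\<close> gives
    \<open>x \<in> K (Suc j) \<subseteq> K j\<close>.\<close>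
  have "K i \<subseteq> K j" if "j \<le> i" for i
    using that
  proof (induction i rule: dec_induct)
    case (step i)
    show ?case
    proof
      fix x assume "x \<in> K (Suc i)"
      then have "x \<in> carrier G" "\<phi> x \<in> K i"
        using \<phi> by (auto simp: K_def hom_def funpow_swap1)
      then have "x \<in> K (Suc j)" using step.IH by (auto simp: K_def funpow_swap1)
      then show "x \<in> K j" using j by blast
    qed
  qed simp
  moreover obtain i where "a \<in> K i" using nil a by (auto simp: K_def)
  ultimately have "a \<in> K j"
    using mono[of i j] by (cases "j \<le> i") auto
  then show ?thesis using mono[OF j(1)] by (auto simp: K_def)
qed

text \<open>
  All orbits of \<open>F\<close> end in the finite cycle through \<open>\<one>\<close>.  On this cycle the linear part of a power of
  \<open>F\<close> has fixed points, and multiples of a fixed point lie on the cycle as well.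
\<close>

lemma affine_hits_one:
  assumes ser: "cyclic_series G H k" and tf: "torsion_free G" and \<phi>: "\<phi> \<in> hom G G"
    and c: "c \<in> carrier G" and F: "\<And>a. a \<in> carrier G \<Longrightarrow> F a = \<phi> a \<otimes> c"
    and hits: "\<And>a. a \<in> carrier G \<Longrightarrow> \<exists>N\<ge>1. (F ^^ N) a = \<one>" and a: "a \<in> carrier G"
  shows "(F ^^ Suc k) a = \<one>"
proof -
  have \<phi>c: "\<phi> \<in> carrier G \<rightarrow> carrier G" using \<phi> by (simp add: hom_def)
  have Fc: "F \<in> carrier G \<rightarrow> carrier G" using F c funcset_mem[OF \<phi>c] by auto
  note [simp] = funpow_in_carrier[OF \<phi>c] funpow_in_carrier[OF Fc] c
  have aff: "(F ^^ n) x = (\<phi> ^^ n) x \<otimes> (F ^^ n) \<one>" if "x \<in> carrier G" for x n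
  proof (induction n)
    case (Suc n)
    have "\<phi> ((\<phi> ^^ n) x \<otimes> (F ^^ n) \<one>) = \<phi> ((\<phi> ^^ n) x) \<otimes> \<phi> ((F ^^ n) \<one>)"
      using \<phi> that by (intro hom_mult) auto
    moreover have "\<phi> ((\<phi> ^^ n) x) \<in> carrier G" "\<phi> ((F ^^ n) \<one>) \<in> carrier G"
      using \<phi>c that by (auto intro!: funcset_mem[OF \<phi>c])
    ultimately show ?case using Suc that by (simp add: F m_assoc)
  qed (use that in simp)
  \<comment> \<open>\<open>q\<close> is a period of the orbit of \<open>\<one>\<close>; at multiples
    of \<open>q\<close> the constant term of the iterate disappears and only the power of
    \<open>\<phi>\<close> remains.\<close>
  obtain q where q: "q \<ge> 1" "(F ^^ q) \<one> = \<one>" using hits[of \<one>] by auto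
  have mult: "(F ^^ (n * q)) \<one> = \<one>" for n
    by (induction n) (auto simp: q funpow_add)
  have cyc: "(F ^^ (n * q)) x = (\<phi> ^^ (n * q)) x" if "x \<in> carrier G" for x n
    using aff[OF that, of "n * q"] mult that by simp
  define C where "C = range (\<lambda>t. (F ^^ t) \<one>)"
  have "C \<subseteq> (\<lambda>t. (F ^^ t) \<one>) ` {..<q}"
  proof
    fix y assume "y \<in> C"
    then obtain t where "y = (F ^^ t) \<one>" by (auto simp: C_def)
    then have "y = (F ^^ (t mod q)) \<one>" using funpow_mod_eq[OF q(2)] by simp
    then show "y \<in> (\<lambda>t. (F ^^ t) \<one>) ` {..<q}" using q by auto
  qed
  then have finC: "finite C" using finite_surj by blast
  \<comment> \<open>As \<open>N * q \<ge> N\<close>, the orbit of \<open>x\<close> has passed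
    through \<open>\<one>\<close> by time \<open>N * q\<close> and stays on the cycle
    \<open>C\<close>.\<close>
  have ends: "(\<phi> ^^ (N * q)) x \<in> C" if "x \<in> carrier G" "(F ^^ N) x = \<one>" for x N
  proof -
    have "N * q = N * (q - 1) + N" using q by (cases q) auto
    then have "(F ^^ (N * q)) x = (F ^^ (N * (q - 1))) \<one>"
      using that by (simp only: funpow_add o_apply)
    then show ?thesis using cyc[OF that(1)] by (auto simp: C_def)
  qed
  have "\<exists>j. (\<phi> ^^ j) x = \<one>" if x: "x \<in> carrier G" for x
  proof -
    obtain N where "(F ^^ N) x = \<one>" using hits x by blast
    then obtain t where e: "(\<phi> ^^ (N * q)) x = (F ^^ t) \<one>" using ends x by (auto simp: C_def)
    define e where "e = (F ^^ t) \<one>"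
    have ec: "e \<in> carrier G" by (simp add: e_def)
    have e_fix: "(\<phi> ^^ (n * q)) e = e" for n
    proof -
      have "(F ^^ (n * q)) e = (F ^^ t) ((F ^^ (n * q)) \<one>)"
        unfolding e_def by (metis add.commute comp_apply funpow_add)
      then show ?thesis using cyc[OF ec] mult by (simp add: e_def)
    qed
    \<comment> \<open>After \<open>M * q\<close> steps \<open>e [^] m\<close> is in
      \<open>C\<close>; the linear map acting there fixes \<open>e\<close>, so
      \<open>e [^] m\<close> itself is in \<open>C\<close>. Finiteness of \<open>C\<close> forces
      \<open>e\<close> to have finite order.\<close>
    have "e [^] m \<in> C" for m :: nat
    proof -
      obtain M where "(F ^^ M) (e [^] m) = \<one>" using hits ec by blast
      then have "(\<phi> ^^ (M * q)) (e [^] m) \<in> C" using ends ec by simp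
      then show ?thesis
        using hom_nat_pow[OF hom_funpow[OF \<phi>] ec is_group is_group] e_fix by simp
    qed
    then have "\<not> inj (\<lambda>m::nat. e [^] m)"
      using finC finite_subset[of "range (\<lambda>m::nat. e [^] m)" C]
      by (auto dest: finite_imageD)
    then obtain m n :: nat where mn: "m \<noteq> n" "e [^] m = e [^] n" by (auto simp: inj_def)
    then have "e [^] (int m - int n) = \<one>"
      using ec by (simp add: int_pow_diff int_pow_int)
    then have "e = \<one>" using tf ec mn unfolding torsion_free_def
      by (metis eq_iff_diff_eq_0 of_nat_eq_iff)
    then have "(\<phi> ^^ (N * q)) x = \<one>" using e by (simp add: e_def)
    then show ?thesis by blast
  qed
  then have nil: "(\<phi> ^^ k) x = \<one>" if "x \<in> carrier G" for x
    using nil_endomorphism[OF ser tf \<phi>] that by blast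
  \<comment> \<open>With the linear part dead, the value no longer depends on the starting
    point.\<close>
  have const: "(F ^^ Suc k) x = (F ^^ Suc k) \<one>" if "x \<in> carrier G" for x
  proof -
    have "(\<phi> ^^ Suc k) x = \<one>" using nil[of "\<phi> x"] that \<phi>c by (auto simp: funpow_swap1)
    then show ?thesis using aff[OF that, of "Suc k"] by (simp del: funpow.simps)
  qed
  \<comment> \<open>The common value is found by starting at a point of the cycle from which
    \<open>Suc k\<close> steps lead to \<open>\<one>\<close>.\<close>
  have "Suc k * q = Suc k + Suc k * (q - 1)" using q by (cases q) auto
  then have "(F ^^ Suc k) ((F ^^ (Suc k * (q - 1))) \<one>) = \<one>"
    using mult[of "Suc k"] by (simp only: funpow_add o_apply)
  then show ?thesis using const[OF a] const[of "(F ^^ (Suc k * (q - 1))) \<one>"] by simp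
qed

text \<open>Ascending the series, \<open>H i\<close> is covered by the translates of
  \<open>H (Suc i)\<close> by powers of \<open>g\<close>, and torsion leaves only finitely many such
  powers.\<close>

lemma finite_torsion_cyclic_series:
  assumes ser: "cyclic_series G H k"
    and tor: "\<And>a. a \<in> carrier G \<Longrightarrow> \<exists>m::int. m \<noteq> 0 \<and> a [^] m = \<one>"
  shows "finite (carrier G)"
proof -
  have "finite (H i)" if "i \<le> k" for i
    using that
  proof (induction i rule: inc_induct)
    case base
    then show ?case using ser by (simp add: cyclic_series_def)
  next
    case (step i)
    obtain g where g: "g \<in> H i" "\<And>x. x \<in> H i \<Longrightarrow> \<exists>s::int. x \<otimes> g [^] s \<in> H (Suc i)"
      using cyclic_series_gen[OF ser step.hyps(2)] by blast
    have sub: "subgroup (H i) G" using ser step.hyps by (simp add: cyclic_series_def)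
    have gc: "g \<in> carrier G" using subgroup.mem_carrier[OF sub g(1)] .
    obtain m :: int where m: "m \<noteq> 0" "g [^] m = \<one>" using tor gc by blast
    have per: "g [^] s = g [^] (s mod \<bar>m\<bar>)" for s :: int
    proof -
      have "g [^] \<bar>m\<bar> = \<one>" using m gc by (auto simp: abs_if int_pow_neg)
      then have "g [^] (\<bar>m\<bar> * (s div \<bar>m\<bar>)) = \<one>"
        using int_pow_pow[OF gc, of "\<bar>m\<bar>" "s div \<bar>m\<bar>"] by simp
      then have "g [^] (\<bar>m\<bar> * (s div \<bar>m\<bar>) + s mod \<bar>m\<bar>) = g [^] (s mod \<bar>m\<bar>)"
        using gc by (simp only: int_pow_mult) simp
      then show ?thesis by simp
    qed
    have "H i \<subseteq> (\<lambda>(h, s). h \<otimes> g [^] s) ` (H (Suc i) \<times> {0..<\<bar>m\<bar>})"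
    proof
      fix x assume x: "x \<in> H i"
      have xc: "x \<in> carrier G" using subgroup.mem_carrier[OF sub x] .
      obtain s :: int where s: "x \<otimes> g [^] s \<in> H (Suc i)" using g x by blast
      have "x = x \<otimes> g [^] s \<otimes> g [^] (- s)"
        using xc gc by (simp add: m_assoc int_pow_neg)
      also have "\<dots> = x \<otimes> g [^] s \<otimes> g [^] (- s mod \<bar>m\<bar>)" by (rule arg_cong[OF per])
      finally show "x \<in> (\<lambda>(h, s). h \<otimes> g [^] s) ` (H (Suc i) \<times> {0..<\<bar>m\<bar>})"
        using s m by (intro image_eqI[where x = "(x \<otimes> g [^] s, - s mod \<bar>m\<bar>)"]) auto
    qed
    with step.IH show ?case by (auto intro: finite_surj)
  qed
  from this[of 0] show ?thesis using ser by (simp add: cyclic_series_def)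
qed

end

section \<open>Polynomial maps\<close>

text \<open>Words in one variable with coefficients from \<open>G\<close>, viewed as maps. Fixing
  all variables of a word but the first gives such a map.\<close>

inductive_set poly_maps :: "('a, 'b) monoid_scheme \<Rightarrow> ('a \<Rightarrow> 'a) set" for G where
  const: "c \<in> carrier G \<Longrightarrow> (\<lambda>_. c) \<in> poly_maps G"
| var: "(\<lambda>u. u) \<in> poly_maps G"
| mult: "f \<in> poly_maps G \<Longrightarrow> g \<in> poly_maps G \<Longrightarrow> (\<lambda>u. f u \<otimes>\<^bsub>G\<^esub> g u) \<in> poly_maps G"
| inv: "f \<in> poly_maps G \<Longrightarrow> (\<lambda>u. inv\<^bsub>G\<^esub> f u) \<in> poly_maps G"

definition hits_one :: "('a, 'b) monoid_scheme \<Rightarrow> ('a \<Rightarrow> 'a) \<Rightarrow> 'a set \<Rightarrow> bool" where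
  "hits_one G f A \<longleftrightarrow> (\<forall>x\<in>A. \<exists>N\<ge>1. (f ^^ N) x = \<one>\<^bsub>G\<^esub>)"

text \<open>The maps are taken over \<open>G\<close>, not over \<open>A\<close>, because a return
  map to \<open>A\<close> can have coefficients outside \<open>A\<close>.\<close>

definition depth_bound :: "('a, 'b) monoid_scheme \<Rightarrow> 'a set \<Rightarrow> nat \<Rightarrow> bool" where
  "depth_bound G A R \<longleftrightarrow> (\<forall>F\<in>poly_maps G. F \<in> A \<rightarrow> A \<longrightarrow> hits_one G F A \<longrightarrow>
     (\<forall>a\<in>A. \<exists>s. 1 \<le> s \<and> s \<le> R \<and> (F ^^ s) a = \<one>\<^bsub>G\<^esub>))"

text \<open>The invariant of the descent. \<open>D\<close> is chosen before \<open>f\<close>, hence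
  independent of the coefficients.\<close>

definition uniformly_reached :: "('a, 'b) monoid_scheme \<Rightarrow> 'a set \<Rightarrow> bool" where
  "uniformly_reached G A \<longleftrightarrow> (\<exists>D. \<forall>f\<in>poly_maps G. hits_one G f (carrier G) \<longrightarrow>
     (\<forall>x\<in>carrier G. \<exists>d. 1 \<le> d \<and> d \<le> D \<and> (f ^^ d) x \<in> A))"

section \<open>Hitting times in finite sets and in torsion-free abelian normal subgroups\<close>

context group
begin

lemma poly_maps_closed: "f \<in> poly_maps G \<Longrightarrow> f \<in> carrier G \<rightarrow> carrier G"
  by (induction rule: poly_maps.induct) auto

lemma poly_maps_compose:
  "f \<in> poly_maps G \<Longrightarrow> g \<in> poly_maps G \<Longrightarrow> (\<lambda>u. f (g u)) \<in> poly_maps G"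
  by (induction rule: poly_maps.induct) (auto intro: poly_maps.intros)

lemma poly_maps_funpow: "f \<in> poly_maps G \<Longrightarrow> f ^^ n \<in> poly_maps G"
proof (induction n)
  case (Suc n)
  then show ?case using poly_maps_compose[of f "f ^^ n"] by (simp add: o_def)
qed (simp add: id_def poly_maps.var)

text \<open>Induction on the shape of \<open>f\<close>. A product contributes the first linear part
  times a conjugate of the second, an inverse a conjugate of the inverted linear part. Normality
  keeps conjugates in \<open>A\<close>, and commutativity keeps products and inverses of
  homomorphisms homomorphic.\<close>

lemma poly_map_affine:
  assumes A: "A \<lhd> G" and comm: "comm_group (G\<lparr>carrier := A\<rparr>)" and f: "f \<in> poly_maps G"
  shows "(\<lambda>a. f a \<otimes> inv f \<one>) \<in> hom (G\<lparr>carrier := A\<rparr>) (G\<lparr>carrier := A\<rparr>)"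
proof -
  interpret A: normal A G by (rule A)
  have c [simp]: "a \<in> carrier G" if "a \<in> A" for a using that by (rule A.mem_carrier)
  have cm: "x \<otimes> y = y \<otimes> x" if "x \<in> A" "y \<in> A" for x y
    using comm_monoid.m_comm[of "G\<lparr>carrier := A\<rparr>"] comm that by (simp add: comm_group_def)
  have "(\<forall>a\<in>A. f a \<otimes> inv f \<one> \<in> A) \<and>
      (\<forall>a\<in>A. \<forall>b\<in>A. f (a \<otimes> b) \<otimes> inv f \<one> = (f a \<otimes> inv f \<one>) \<otimes> (f b \<otimes> inv f \<one>))"
    using f
  proof (induction rule: poly_maps.induct)
    case (mult f g)
    have fg [simp]: "f x \<in> carrier G" "g x \<in> carrier G" if "x \<in> carrier G" for x
      using mult.hyps that poly_maps_closed by blast+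
    \<comment> \<open>These are the linear parts of the two factors, the second conjugated by
      \<open>f \<one>\<close> since it has to move past that constant.\<close>
    define \<alpha> where "\<alpha> a = f a \<otimes> inv f \<one>" for a
    define \<beta> where "\<beta> a = f \<one> \<otimes> (g a \<otimes> inv g \<one>) \<otimes> inv f \<one>" for a
    have split: "f a \<otimes> g a \<otimes> inv (f \<one> \<otimes> g \<one>) = \<alpha> a \<otimes> \<beta> a" if "a \<in> carrier G" for a
    proof -
      have "\<alpha> a \<otimes> \<beta> a = f a \<otimes> (inv f \<one> \<otimes> f \<one>) \<otimes> g a \<otimes> inv g \<one> \<otimes> inv f \<one>"
        using that by (simp only: \<alpha>_def \<beta>_def m_assoc m_closed inv_closed fg one_closed)
      then show ?thesis using that by (simp add: m_assoc inv_mult_group)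
    qed
    have \<alpha>A: "\<alpha> a \<in> A" and \<beta>A: "\<beta> a \<in> A" if "a \<in> A" for a
      using mult.IH that A.inv_op_closed2[of "f \<one>"] by (auto simp: \<alpha>_def \<beta>_def)
    have "\<alpha> (a \<otimes> b) = \<alpha> a \<otimes> \<alpha> b" if "a \<in> A" "b \<in> A" for a b
      using mult.IH that by (simp add: \<alpha>_def)
    moreover have "\<beta> (a \<otimes> b) = \<beta> a \<otimes> \<beta> b" if "a \<in> A" "b \<in> A" for a b
    proof -
      have "\<beta> a \<otimes> \<beta> b = f \<one> \<otimes> (g a \<otimes> inv g \<one>) \<otimes> (inv f \<one> \<otimes> f \<one>) \<otimes> (g b \<otimes> inv g \<one>) \<otimes> inv f \<one>"
        using that by (simp only: \<beta>_def m_assoc m_closed inv_closed fg one_closed c)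
      also have "\<dots> = f \<one> \<otimes> ((g a \<otimes> inv g \<one>) \<otimes> (g b \<otimes> inv g \<one>)) \<otimes> inv f \<one>"
        using that by (simp add: m_assoc)
      also have "\<dots> = \<beta> (a \<otimes> b)" using mult.IH that by (simp add: \<beta>_def)
      finally show ?thesis by simp
    qed
    \<comment> \<open>Commutativity of \<open>A\<close> allows \<open>\<alpha> b\<close> and
      \<open>\<beta> a\<close> to be interchanged.\<close>
    moreover have "\<alpha> a \<otimes> \<alpha> b \<otimes> (\<beta> a \<otimes> \<beta> b) = \<alpha> a \<otimes> \<beta> a \<otimes> (\<alpha> b \<otimes> \<beta> b)" if "a \<in> A" "b \<in> A" for a b
    proof -
      have "\<alpha> b \<otimes> (\<beta> a \<otimes> \<beta> b) = \<beta> a \<otimes> (\<alpha> b \<otimes> \<beta> b)"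
        using that \<alpha>A \<beta>A cm[of "\<alpha> b" "\<beta> a"] by (simp flip: m_assoc)
      then show ?thesis using that \<alpha>A \<beta>A by (simp add: m_assoc)
    qed
    ultimately show ?case using \<alpha>A \<beta>A by (auto simp: split)
  next
    case (inv f)
    have fc [simp]: "f x \<in> carrier G" if "x \<in> carrier G" for x
      using inv.hyps that poly_maps_closed by blast
    define \<alpha> where "\<alpha> a = f a \<otimes> inv f \<one>" for a
    have eq: "inv f a \<otimes> f \<one> = inv f \<one> \<otimes> inv (\<alpha> a) \<otimes> f \<one>" if "a \<in> carrier G" for a
    proof -
      have "inv f \<one> \<otimes> inv (\<alpha> a) \<otimes> f \<one> = (inv f \<one> \<otimes> f \<one>) \<otimes> inv f a \<otimes> f \<one>"
        using that by (simp only: \<alpha>_def inv_mult_group inv_inv m_assoc m_closed inv_closed fc one_closed)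
      then show ?thesis using that by simp
    qed
    have \<alpha>A: "\<alpha> a \<in> A" if "a \<in> A" for a using inv.IH that by (auto simp: \<alpha>_def)
    have "inv (\<alpha> (a \<otimes> b)) = inv (\<alpha> a) \<otimes> inv (\<alpha> b)" if "a \<in> A" "b \<in> A" for a b
    proof -
      have "\<alpha> (a \<otimes> b) = \<alpha> b \<otimes> \<alpha> a" using inv.IH that cm[OF \<alpha>A \<alpha>A] by (simp add: \<alpha>_def)
      then show ?thesis using that \<alpha>A by (simp add: inv_mult_group)
    qed
    moreover have "inv f \<one> \<otimes> (x \<otimes> y) \<otimes> f \<one> = inv f \<one> \<otimes> x \<otimes> f \<one> \<otimes> (inv f \<one> \<otimes> y \<otimes> f \<one>)"
      if "x \<in> carrier G" "y \<in> carrier G" for x y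
    proof -
      have "inv f \<one> \<otimes> x \<otimes> f \<one> \<otimes> (inv f \<one> \<otimes> y \<otimes> f \<one>) = inv f \<one> \<otimes> x \<otimes> (f \<one> \<otimes> inv f \<one>) \<otimes> y \<otimes> f \<one>"
        using that by (simp only: m_assoc m_closed inv_closed fc one_closed)
      then show ?thesis using that by (simp add: m_assoc)
    qed
    moreover have "inv f \<one> \<otimes> inv (\<alpha> a) \<otimes> f \<one> \<in> A" if "a \<in> A" for a
      using that \<alpha>A A.inv_op_closed1[of "f \<one>"] by simp
    ultimately show ?case using \<alpha>A by (auto simp: eq)
  qed auto
  then show ?thesis by (auto simp: hom_def)
qed

text \<open>Up to the first hit the orbit cannot repeat a value, since skipping the loop would give
  an earlier hit; so the times from 1 to the first hit inject into \<open>A\<close>.\<close>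

lemma depth_bound_finite:
  assumes "finite A"
  shows "depth_bound G A (card A)"
  unfolding depth_bound_def
proof (intro ballI impI)
  fix F a assume F: "F \<in> A \<rightarrow> A" "hits_one G F A" and a: "a \<in> A"
  define s where "s = (LEAST N. N \<ge> 1 \<and> (F ^^ N) a = \<one>)"
  have s: "s \<ge> 1" "(F ^^ s) a = \<one>"
    using LeastI_ex[of "\<lambda>N. N \<ge> 1 \<and> (F ^^ N) a = \<one>"] F a by (auto simp: s_def hits_one_def)
  have min: "s \<le> N" if "N \<ge> 1" "(F ^^ N) a = \<one>" for N
    using that by (auto simp: s_def intro: Least_le)
  have neq: "(F ^^ i) a \<noteq> (F ^^ j) a" if "1 \<le> i" "i < j" "j \<le> s" for i j
  proof
    assume eq: "(F ^^ i) a = (F ^^ j) a"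
    have "(F ^^ (s - j + i)) a = (F ^^ (s - j + j)) a" by (simp only: funpow_add o_apply eq)
    then have "s \<le> s - j + i" using that s min[of "s - j + i"] by simp
    then show False using that by simp
  qed
  have "inj_on (\<lambda>i. (F ^^ i) a) {1..s}"
    using neq by (intro inj_onI) (metis atLeastAtMost_iff linorder_neqE_nat)
  moreover have "(\<lambda>i. (F ^^ i) a) ` {1..s} \<subseteq> A"
    using funpow_in_carrier[OF F(1) a] by auto
  ultimately have "card {1..s} \<le> card A" using assms by (intro card_inj_on_le)
  then show "\<exists>s. 1 \<le> s \<and> s \<le> card A \<and> (F ^^ s) a = \<one>" using s by auto
qed

text \<open>By \<open>poly_map_affine\<close>, \<open>F\<close> acts on \<open>A\<close> as an
  affine map with constant \<open>F \<one>\<close>. The bound \<open>Suc k\<close> keeps the hitting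
  time positive when \<open>k = 0\<close>.\<close>

lemma depth_bound_torsion_free:
  assumes A: "A \<lhd> G" and comm: "comm_group (G\<lparr>carrier := A\<rparr>)"
    and "torsion_free (G\<lparr>carrier := A\<rparr>)" "cyclic_series (G\<lparr>carrier := A\<rparr>) H k"
  shows "depth_bound G A (Suc k)"
  unfolding depth_bound_def
proof (intro ballI impI)
  fix F a assume F: "F \<in> poly_maps G" "F \<in> A \<rightarrow> A" "hits_one G F A" and a: "a \<in> A"
  interpret A: comm_group "G\<lparr>carrier := A\<rparr>" by (rule comm)
  have sub: "subgroup A G" using A by (rule normal_imp_subgroup)
  note c = subgroup.mem_carrier[OF sub]
  have F1: "F \<one> \<in> A" using F subgroup.one_closed[OF sub] by blast
  have "F b = (F b \<otimes> inv F \<one>) \<otimes> F \<one>" if "b \<in> A" for b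
    using that F F1 c by (simp add: m_assoc Pi_iff)
  then have "(F ^^ Suc k) a = \<one>"
    using A.affine_hits_one[OF assms(4,3) poly_map_affine[OF A comm F(1)], of "F \<one>" F a] F1 F(3) a
    by (simp add: hits_one_def)
  then show "\<exists>s. 1 \<le> s \<and> s \<le> Suc k \<and> (F ^^ s) a = \<one>" by (intro exI[of _ "Suc k"]) simp
qed

end

section \<open>Passage to quotient groups\<close>

context group_hom
begin

text \<open>\<open>f'\<close> arises by applying \<open>h\<close> to every coefficient of
  \<open>f\<close>.\<close>

lemma poly_map_image:
  assumes "f \<in> poly_maps G"
  shows "\<exists>f'\<in>poly_maps H. \<forall>x\<in>carrier G. h (f x) = f' (h x)"
  using assms
proof (induction rule: poly_maps.induct)
  case (const c)
  then show ?case by (intro bexI[OF _ poly_maps.const[of "h c"]]) auto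
next
  case var
  show ?case by (intro bexI[OF _ poly_maps.var]) auto
next
  case (mult f g)
  then obtain f' g' where *: "f' \<in> poly_maps H" "\<And>x. x \<in> carrier G \<Longrightarrow> h (f x) = f' (h x)"
    "g' \<in> poly_maps H" "\<And>x. x \<in> carrier G \<Longrightarrow> h (g x) = g' (h x)"
    by blast
  have "f x \<in> carrier G" "g x \<in> carrier G" if "x \<in> carrier G" for x
    using mult.hyps that G.poly_maps_closed by blast+
  then show ?case using * by (intro bexI[OF _ poly_maps.mult[OF *(1,3)]]) auto
next
  case (inv f)
  then obtain f' where *: "f' \<in> poly_maps H" "\<And>x. x \<in> carrier G \<Longrightarrow> h (f x) = f' (h x)"
    by blast
  have "f x \<in> carrier G" if "x \<in> carrier G" for x
    using inv.hyps that G.poly_maps_closed by blast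
  then show ?case using * by (intro bexI[OF _ poly_maps.inv[OF *(1)]]) auto
qed

lemma funpow_image:
  assumes "f \<in> poly_maps G" "\<forall>x\<in>carrier G. h (f x) = f' (h x)" "x \<in> carrier G"
  shows "h ((f ^^ n) x) = (f' ^^ n) (h x)"
  using assms funpow_in_carrier[OF G.poly_maps_closed] by (induction n) auto

end

lemma (in normal) group_hom_Mod: "group_hom G (G Mod H) (\<lambda>a. H #> a)"
  using r_coset_hom_Mod factorgroup_is_group is_group
  by (simp add: group_hom_def group_hom_axioms_def)

lemma (in group) poly_map_coset:
  assumes A: "A \<lhd> G" and f: "f \<in> poly_maps G" and x: "x \<in> carrier G" "y \<in> carrier G" "A #> x = A #> y"
  shows "A #> f x = A #> f y"
  using group_hom.poly_map_image[OF normal.group_hom_Mod[OF A] f] x by metis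

lemma (in group) rcoset_eq_self_iff: "subgroup A G \<Longrightarrow> x \<in> carrier G \<Longrightarrow> A #> x = A \<longleftrightarrow> x \<in> A"
  by (metis coset_join1 coset_join2)

text \<open>
  The first return to \<open>A\<close> of the orbit of \<open>\<one>\<close> happens at a time \<open>p\<close> with \<open>1 \<le> p \<le> D\<close>.
  As \<open>f\<close> respects cosets of \<open>A\<close>, its \<open>p\<close>-th iterate maps \<open>A\<close> to itself, and all
  visits to \<open>A\<close> of an orbit starting in \<open>A\<close> happen at multiples of \<open>p\<close>.
\<close>

lemma (in group) orbit_bound_from_normal:
  assumes A: "A \<lhd> G" and f: "f \<in> poly_maps G" "hits_one G f (carrier G)"
    and D: "\<And>x. x \<in> carrier G \<Longrightarrow> \<exists>d. 1 \<le> d \<and> d \<le> D \<and> (f ^^ d) x \<in> A"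
    and R: "depth_bound G A R" and x: "x \<in> carrier G"
  shows "\<exists>d. 1 \<le> d \<and> d \<le> D + D * R \<and> (f ^^ d) x = \<one>"
proof -
  have sub: "subgroup A G" using A by (rule normal_imp_subgroup)
  note c [simp] = subgroup.mem_carrier[OF sub]
  have fc [simp]: "(f ^^ n) y \<in> carrier G" if "y \<in> carrier G" for n y
    using funpow_in_carrier[OF poly_maps_closed[OF f(1)]] that by simp
  have inA: "(f ^^ n) a \<in> A \<longleftrightarrow> (f ^^ n) \<one> \<in> A" if a: "a \<in> A" for n a
  proof -
    have "A #> a = A #> \<one>" using a sub coset_join2 subgroup.one_closed[OF sub] by simp
    then have "A #> (f ^^ n) a = A #> (f ^^ n) \<one>"
      using poly_map_coset[OF A poly_maps_funpow[OF f(1)]] a by simp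
    then show ?thesis using rcoset_eq_self_iff[OF sub] a by (metis c fc one_closed)
  qed
  define p where "p = (LEAST p. p \<ge> 1 \<and> (f ^^ p) \<one> \<in> A)"
  have p: "p \<ge> 1" "(f ^^ p) \<one> \<in> A"
    using LeastI_ex[of "\<lambda>p. p \<ge> 1 \<and> (f ^^ p) \<one> \<in> A"] D[OF one_closed] by (auto simp: p_def)
  have min: "p \<le> n" if "n \<ge> 1" "(f ^^ n) \<one> \<in> A" for n
    using that by (auto simp: p_def intro: Least_le)
  have "p \<le> D" using D[OF one_closed] min le_trans by blast
  define F where "F = f ^^ p"
  have FA: "F \<in> A \<rightarrow> A" using inA p by (auto simp: F_def)
  have Fn: "(F ^^ n) y = (f ^^ (n * p)) y" for n y by (simp add: F_def funpow_mult mult.commute)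
  have "hits_one G F A"
    unfolding hits_one_def
  proof
    fix a assume a: "a \<in> A"
    obtain N where N: "N \<ge> 1" "(f ^^ N) a = \<one>" using f(2) c[OF a] unfolding hits_one_def by blast
    \<comment> \<open>Split \<open>N\<close> by division by \<open>p\<close>. The full returns lead
      to a point \<open>b\<close> of \<open>A\<close>; reaching \<open>\<one>\<close> in
      \<open>N mod p < p\<close> further steps would be a return before the first one unless the
      remainder is zero.\<close>
    define b where "b = (F ^^ (N div p)) a"
    have b: "b \<in> A" using funpow_in_carrier[OF FA a] by (simp add: b_def)
    have "(f ^^ (N mod p + N div p * p)) a = (f ^^ (N mod p)) b"
      by (simp only: funpow_add o_apply Fn b_def)
    then have "(f ^^ (N mod p)) b = \<one>" using N by simp
    then have "(f ^^ (N mod p)) \<one> \<in> A" using inA[OF b, of "N mod p"] subgroup.one_closed[OF sub] by simp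
    moreover have "N mod p < p" using p by simp
    ultimately have "N mod p = 0" using min[of "N mod p"] by linarith
    then have "N = N div p * p" by (simp add: mod_eq_0_iff_dvd)
    then have "(F ^^ (N div p)) a = \<one>" "N div p \<ge> 1" using N Fn by (metis, metis less_one mult_0 not_less)
    then show "\<exists>N\<ge>1. (F ^^ N) a = \<one>" by blast
  qed
  then have R': "\<exists>s. 1 \<le> s \<and> s \<le> R \<and> (F ^^ s) a = \<one>" if "a \<in> A" for a
    using R FA poly_maps_funpow[OF f(1)] that unfolding depth_bound_def F_def by blast
  obtain d where d: "1 \<le> d" "d \<le> D" "(f ^^ d) x \<in> A" using D x by blast
  then obtain s where s: "1 \<le> s" "s \<le> R" "(F ^^ s) ((f ^^ d) x) = \<one>" using R' by blast
  have "(f ^^ (s * p + d)) x = \<one>" using s by (simp add: funpow_add Fn)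
  moreover have "s * p + d \<le> D + D * R"
    using mult_le_mono[OF s(2) \<open>p \<le> D\<close>] d by (simp add: mult.commute)
  ultimately show ?thesis using d by (intro exI[of _ "s * p + d"]) simp
qed

text \<open>\<open>orbit_bound_from_normal\<close> is applied in \<open>G Mod M\<close> to the image
  of \<open>N\<close>; hitting the trivial coset means entering \<open>M\<close>.\<close>

lemma (in group) uniformly_reached_step:
  assumes M: "M \<lhd> G" and N: "N \<lhd> G" and reach: "uniformly_reached G N"
    and bd: "depth_bound (G Mod M) ((\<lambda>a. M #> a) ` N) R"
  shows "uniformly_reached G M"
proof -
  interpret M: normal M G by (rule M)
  interpret N: normal N G by (rule N)
  interpret h: group_hom G "G Mod M" "\<lambda>a. M #> a" by (rule M.group_hom_Mod)
  have A: "(\<lambda>a. M #> a) ` N \<lhd> G Mod M"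
    using N.surj_hom_normal_subgroup[OF M.group_hom_Mod] by (simp add: carrier_FactGroup)
  obtain D where D: "\<And>f x. f \<in> poly_maps G \<Longrightarrow> hits_one G f (carrier G) \<Longrightarrow> x \<in> carrier G \<Longrightarrow>
      \<exists>d. 1 \<le> d \<and> d \<le> D \<and> (f ^^ d) x \<in> N"
    using reach unfolding uniformly_reached_def by blast
  have "\<exists>d. 1 \<le> d \<and> d \<le> D + D * R \<and> (f ^^ d) x \<in> M"
    if f: "f \<in> poly_maps G" "hits_one G f (carrier G)" and x: "x \<in> carrier G" for f x
  proof -
    obtain f' where f': "f' \<in> poly_maps (G Mod M)" "\<forall>x\<in>carrier G. M #> f x = f' (M #> x)"
      using h.poly_map_image[OF f(1)] by blast
    note iter = h.funpow_image[OF f(1) f'(2)]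
    have M1: "M #> \<one> = M" by (simp add: rcoset_eq_self_iff M.subgroup_axioms)
    have "hits_one (G Mod M) f' (carrier (G Mod M))"
      unfolding hits_one_def carrier_FactGroup
    proof (clarsimp)
      fix y assume y: "y \<in> carrier G"
      then obtain n where "n \<ge> 1" "(f ^^ n) y = \<one>" using f(2) by (auto simp: hits_one_def)
      then show "\<exists>n\<ge>Suc 0. (f' ^^ n) (M #> y) = M" using iter[OF y, of n] M1 by auto
    qed
    moreover have "\<exists>d. 1 \<le> d \<and> d \<le> D \<and> (f' ^^ d) X \<in> (\<lambda>a. M #> a) ` N"
      if X: "X \<in> carrier (G Mod M)" for X
    proof -
      obtain y where y: "y \<in> carrier G" "X = M #> y" using X by (auto simp: carrier_FactGroup)
      then show ?thesis using D[OF f y(1)] iter[OF y(1)] by (metis imageI)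
    qed
    ultimately obtain d where d: "1 \<le> d" "d \<le> D + D * R" "(f' ^^ d) (M #> x) = M"
      using group.orbit_bound_from_normal[OF h.H.is_group A f'(1) _ _ bd, of D "M #> x"] x by auto
    then have "M #> (f ^^ d) x = M" using iter[OF x] by simp
    then have "(f ^^ d) x \<in> M"
      using rcoset_eq_self_iff[OF M.subgroup_axioms] funpow_in_carrier[OF poly_maps_closed[OF f(1)] x] by simp
    then show ?thesis using d by blast
  qed
  then show ?thesis unfolding uniformly_reached_def by blast
qed

section \<open>Polycyclic groups\<close>

text \<open>The usual proof that a subgroup of a cyclic group is cyclic, for the image of
  \<open>L\<close>: an element whose image has the least positive exponent serves as
  \<open>g\<close>.\<close>

lemma (in group_hom) subgroup_generator_mod_kernel:
  assumes cyc: "cyclic_group H" and L: "subgroup L G"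
  shows "\<exists>g\<in>L. \<forall>x\<in>L. \<exists>s::int. h (x \<otimes> g [^] s) = \<one>\<^bsub>H\<^esub>"
proof -
  note c [simp] = subgroup.mem_carrier[OF L]
  obtain z where z: "z \<in> carrier H" "carrier H = range (\<lambda>n::int. z [^]\<^bsub>H\<^esub> n)"
    using cyc H.cyclic_group by blast
  have expo: "\<exists>n::int. h x = z [^]\<^bsub>H\<^esub> n" if "x \<in> L" for x
    using z(2) hom_closed[OF c[OF that]] by auto
  define P where "P n \<longleftrightarrow> n > 0 \<and> (\<exists>x\<in>L. h x = z [^]\<^bsub>H\<^esub> int n)" for n
  show ?thesis
  proof (cases "\<exists>n. P n")
    case False
    \<comment> \<open>Without positive exponents there are, by inversion, no negative ones either;
      so \<open>L\<close> lies in the kernel and \<open>\<one>\<close> serves as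
      \<open>g\<close>.\<close>
    have "h (x \<otimes> \<one> [^] (0::int)) = \<one>\<^bsub>H\<^esub>" if x: "x \<in> L" for x
    proof -
      obtain n :: int where n: "h x = z [^]\<^bsub>H\<^esub> n" using expo x by blast
      have "h (inv x) = z [^]\<^bsub>H\<^esub> (- n)" using x n z by (simp add: H.int_pow_neg)
      then have "P (nat (- n))" if "n < 0"
        using that subgroup.m_inv_closed[OF L x] unfolding P_def by (auto intro!: bexI[of _ "inv x"])
      moreover have "P (nat n)" if "n > 0"
        using that x n unfolding P_def by (auto intro!: bexI[of _ x])
      ultimately have "n = 0" using False by (meson linorder_neqE_linordered_idom)
      then show ?thesis using x n by simp
    qed
    then show ?thesis using subgroup.one_closed[OF L] by blast
  next
    case True
    define b where "b = (LEAST n. P n)"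
    have "P b" using True by (auto simp: b_def intro: LeastI_ex)
    then obtain g where g: "g \<in> L" "h g = z [^]\<^bsub>H\<^esub> int b" and b: "b > 0" by (auto simp: P_def)
    have min: "b \<le> n" if "P n" for n using that by (simp add: b_def Least_le)
    \<comment> \<open>Division by \<open>b\<close> leaves an exponent below \<open>b\<close> that
      again belongs to an element of \<open>L\<close>, so minimality makes it zero.\<close>
    have "h (x \<otimes> g [^] (- (n div int b))) = \<one>\<^bsub>H\<^esub>" if x: "x \<in> L" and n: "h x = z [^]\<^bsub>H\<^esub> n" for x and n :: int
    proof -
      have "h (x \<otimes> g [^] (- (n div int b))) = h x \<otimes>\<^bsub>H\<^esub> h g [^]\<^bsub>H\<^esub> (- (n div int b))"
        using x g(1) by (simp add: hom_int_pow)
      also have "\<dots> = z [^]\<^bsub>H\<^esub> (n + int b * (- (n div int b)))"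
        using n g(2) z(1) by (simp only: H.int_pow_mult H.int_pow_pow)
      finally have "h (x \<otimes> g [^] (- (n div int b))) = z [^]\<^bsub>H\<^esub> (n + int b * (- (n div int b)))" .
      then have eq: "h (x \<otimes> g [^] (- (n div int b))) = z [^]\<^bsub>H\<^esub> int (nat (n mod int b))"
        using b by (simp add: minus_mult_div_eq_mod)
      have "x \<otimes> g [^] (- (n div int b)) \<in> L"
        by (intro subgroup.m_closed[OF L] x G.subgroup_int_pow_closed[OF L] g(1))
      then have "P (nat (n mod int b))" if "nat (n mod int b) > 0"
        using eq that unfolding P_def by blast
      moreover have "nat (n mod int b) < b" using b by (simp add: nat_less_iff)
      ultimately have "nat (n mod int b) = 0" using min[of "nat (n mod int b)"] by linarith
      then show ?thesis using eq by simp
    qed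
    then show ?thesis using g(1) expo by blast
  qed
qed

lemma cyclic_series_image:
  assumes hom: "group_hom G K h" and surj: "h ` carrier G = carrier K" and ser: "cyclic_series G H k"
  shows "cyclic_series K (\<lambda>i. h ` H i) k"
proof -
  interpret group_hom G K h by (rule hom)
  have "\<exists>g\<in>h ` H i. \<forall>x\<in>h ` H i. \<exists>s::int. x \<otimes>\<^bsub>K\<^esub> g [^]\<^bsub>K\<^esub> s \<in> h ` H (Suc i)" if "i < k" for i
  proof -
    have sub: "subgroup (H i) G" using ser that by (simp add: cyclic_series_def)
    note c [simp] = subgroup.mem_carrier[OF sub]
    obtain g where g: "g \<in> H i" "\<And>x. x \<in> H i \<Longrightarrow> \<exists>s::int. x \<otimes>\<^bsub>G\<^esub> g [^]\<^bsub>G\<^esub> s \<in> H (Suc i)"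
      using cyclic_series_gen[OF ser \<open>i < k\<close>] by blast
    have "\<exists>s::int. h x \<otimes>\<^bsub>K\<^esub> h g [^]\<^bsub>K\<^esub> s \<in> h ` H (Suc i)" if x: "x \<in> H i" for x
    proof -
      obtain s :: int where s: "x \<otimes>\<^bsub>G\<^esub> g [^]\<^bsub>G\<^esub> s \<in> H (Suc i)" using g(2) x by blast
      have "h x \<otimes>\<^bsub>K\<^esub> h g [^]\<^bsub>K\<^esub> s = h (x \<otimes>\<^bsub>G\<^esub> g [^]\<^bsub>G\<^esub> s)"
        using x g(1) by (simp add: hom_int_pow)
      then show ?thesis using s by auto
    qed
    then show ?thesis using g(1) by blast
  qed
  moreover have "subgroup (h ` H i) K" if "i \<le> k" for i
    using ser that subgroup_img_is_subgroup by (simp add: cyclic_series_def)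
  ultimately show ?thesis using ser surj by (simp add: cyclic_series_def)
qed

section \<open>Series and torsion in the factors of a polycyclic group\<close>

context group
begin

lemma polycyclic_series_subgroup:
  assumes "H 0 = carrier G" "\<forall>i<k. H (Suc i) \<lhd> (G\<lparr>carrier := H i\<rparr>)"
  shows "i \<le> k \<Longrightarrow> subgroup (H i) G"
proof (induction i)
  case (Suc i)
  then show ?case
    using assms(2) normal_imp_subgroup incl_subgroup by (meson Suc_le_lessD Suc_leD)
qed (use assms subgroup_self in simp)

text \<open>The image of \<open>L \<inter> H i\<close> in the cyclic factor of \<open>H i\<close> is
  again cyclic, and a preimage of its generator serves as \<open>g\<close>.\<close>

lemma cyclic_series_subgroup:
  assumes H: "H 0 = carrier G" "H k = {\<one>}"
      "\<forall>i<k. H (Suc i) \<lhd> (G\<lparr>carrier := H i\<rparr>) \<and> cyclic_group ((G\<lparr>carrier := H i\<rparr>) Mod H (Suc i))"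
    and L: "subgroup L G"
  shows "cyclic_series (G\<lparr>carrier := L\<rparr>) (\<lambda>i. L \<inter> H i) k"
proof -
  have sub: "subgroup (H i) G" if "i \<le> k" for i
    using polycyclic_series_subgroup[of H k i] H that by blast
  note Lc [simp] = subgroup.mem_carrier[OF L]
  have "\<exists>g\<in>L \<inter> H i. \<forall>x\<in>L \<inter> H i. \<exists>s::int. x \<otimes> g [^]\<^bsub>G\<lparr>carrier := L\<rparr>\<^esub> s \<in> L \<inter> H (Suc i)"
    if i: "i < k" for i
  proof -
    have Hi: "subgroup (H i) G" using sub i by simp
    define K where "K = G\<lparr>carrier := H i\<rparr>"
    have grp: "group K" unfolding K_def by (rule subgroup_imp_group[OF Hi])
    have N: "H (Suc i) \<lhd> K" and cyc: "cyclic_group (K Mod H (Suc i))" using H(3) i by (auto simp: K_def)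
    interpret K: group K by (rule grp)
    interpret N: normal "H (Suc i)" K by (rule N)
    interpret q: group_hom K "K Mod H (Suc i)" "\<lambda>a. H (Suc i) #>\<^bsub>K\<^esub> a" by (rule N.group_hom_Mod)
    have "subgroup (L \<inter> H i) K"
      unfolding K_def by (rule subgroup_incl) (use subgroups_Inter_pair L Hi in auto)
    then obtain g where g: "g \<in> L \<inter> H i"
      "\<And>x. x \<in> L \<inter> H i \<Longrightarrow> \<exists>s::int. H (Suc i) #>\<^bsub>K\<^esub> (x \<otimes>\<^bsub>K\<^esub> g [^]\<^bsub>K\<^esub> s) = H (Suc i)"
      using q.subgroup_generator_mod_kernel[OF cyc] by (metis one_FactGroup)
    have "\<exists>s::int. x \<otimes> g [^]\<^bsub>G\<lparr>carrier := L\<rparr>\<^esub> s \<in> L \<inter> H (Suc i)" if x: "x \<in> L \<inter> H i" for x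
    proof -
      obtain s :: int where s: "H (Suc i) #>\<^bsub>K\<^esub> (x \<otimes>\<^bsub>K\<^esub> g [^]\<^bsub>K\<^esub> s) = H (Suc i)" using g(2) x by blast
      have "x \<in> carrier K" "g \<in> carrier K" using x g(1) by (auto simp: K_def)
      then have "x \<otimes>\<^bsub>K\<^esub> g [^]\<^bsub>K\<^esub> s \<in> carrier K" by simp
      then have "x \<otimes>\<^bsub>K\<^esub> g [^]\<^bsub>K\<^esub> s \<in> H (Suc i)"
        using s K.rcoset_eq_self_iff[OF N.subgroup_axioms] by blast
      \<comment> \<open>Integer powers formally depend on the carrier through the inverse; the
        powers taken in the three groups agree.\<close>
      moreover have "g [^]\<^bsub>K\<^esub> s = g [^] s"
        using int_pow_consistent[OF Hi, of g s] g(1) by (simp add: K_def)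
      moreover have "g [^]\<^bsub>G\<lparr>carrier := L\<rparr>\<^esub> s = g [^] s"
        using int_pow_consistent[OF L, of g s] g(1) by simp
      moreover have "x \<otimes> g [^] s \<in> L"
        using x g(1) by (intro subgroup.m_closed[OF L] subgroup_int_pow_closed[OF L]) auto
      ultimately show ?thesis by (intro exI[of _ s]) (simp add: K_def)
    qed
    then show ?thesis using g(1) by blast
  qed
  moreover have "subgroup (L \<inter> H i) (G\<lparr>carrier := L\<rparr>)" if "i \<le> k" for i
    by (rule subgroup_incl) (use subgroups_Inter_pair L sub[OF that] in auto)
  moreover have "L \<inter> H 0 = L" "L \<inter> H k = {\<one>}"
    using H subgroup.subset[OF L] subgroup.one_closed[OF L] by auto
  ultimately show ?thesis by (simp add: cyclic_series_def)
qed

text \<open>The given series is first intersected with \<open>N\<close>, then projected modulo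
  \<open>M\<close>.\<close>

lemma cyclic_series_factor:
  assumes poly: "polycyclic G" and M: "M \<lhd> G" and N: "subgroup N G"
  shows "\<exists>H k. cyclic_series ((G Mod M)\<lparr>carrier := (\<lambda>a. M #> a) ` N\<rparr>) H k"
proof -
  interpret M: normal M G by (rule M)
  interpret q: group_hom G "G Mod M" "\<lambda>a. M #> a" by (rule M.group_hom_Mod)
  obtain H k where H: "H 0 = carrier G" "H k = {\<one>}"
      "\<forall>i<k. H (Suc i) \<lhd> (G\<lparr>carrier := H i\<rparr>) \<and> cyclic_group ((G\<lparr>carrier := H i\<rparr>) Mod H (Suc i))"
    using poly unfolding polycyclic_def by blast
  have "group_hom (G\<lparr>carrier := N\<rparr>) ((G Mod M)\<lparr>carrier := (\<lambda>a. M #> a) ` N\<rparr>) (\<lambda>a. M #> a)"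
    using subgroup_imp_group[OF N] q.H.subgroup_imp_group[OF q.subgroup_img_is_subgroup[OF N]]
      q.hom_mult subgroup.mem_carrier[OF N]
    by (auto simp: group_hom_def group_hom_axioms_def hom_def)
  then show ?thesis
    using cyclic_series_image[OF _ _ cyclic_series_subgroup[OF H N]] by fastforce
qed

text \<open>The product \<open>x y\<close> equals \<open>[x, y] y x\<close>, and the commutator
  vanishes modulo \<open>M\<close>.\<close>

lemma comm_group_factor:
  assumes M: "M \<lhd> G" and N: "subgroup N G" and der: "derived G N \<subseteq> M"
  shows "comm_group ((G Mod M)\<lparr>carrier := (\<lambda>a. M #> a) ` N\<rparr>)"
proof (rule group.group_comm_groupI)
  interpret M: normal M G by (rule M)
  interpret q: group_hom G "G Mod M" "\<lambda>a. M #> a" by (rule M.group_hom_Mod)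
  show "group ((G Mod M)\<lparr>carrier := (\<lambda>a. M #> a) ` N\<rparr>)"
    by (rule q.H.subgroup_imp_group[OF q.subgroup_img_is_subgroup[OF N]])
  note c [simp] = subgroup.mem_carrier[OF N]
  fix X Y assume "X \<in> carrier ((G Mod M)\<lparr>carrier := (\<lambda>a. M #> a) ` N\<rparr>)"
    "Y \<in> carrier ((G Mod M)\<lparr>carrier := (\<lambda>a. M #> a) ` N\<rparr>)"
  then obtain x y where xy: "x \<in> N" "y \<in> N" "X = M #> x" "Y = M #> y" by auto
  have "x \<otimes> y \<otimes> inv x \<otimes> inv y \<in> M"
    using der xy unfolding derived_def by (auto intro!: generate.incl)
  moreover have comm: "x \<otimes> y \<otimes> inv x \<otimes> inv y \<in> carrier G" "y \<otimes> x \<in> carrier G" using xy by simp_all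
  ultimately have "M #> (x \<otimes> y \<otimes> inv x \<otimes> inv y) = \<one>\<^bsub>G Mod M\<^esub>"
    using rcoset_eq_self_iff[OF M.subgroup_axioms] by (metis one_FactGroup)
  then have "M #> ((x \<otimes> y \<otimes> inv x \<otimes> inv y) \<otimes> (y \<otimes> x)) = M #> (y \<otimes> x)"
    using q.hom_mult[OF comm] q.H.l_one[OF q.hom_closed[OF comm(2)]] by simp
  moreover have "(x \<otimes> y \<otimes> inv x \<otimes> inv y) \<otimes> (y \<otimes> x) = x \<otimes> y"
  proof -
    have "(x \<otimes> y \<otimes> inv x \<otimes> inv y) \<otimes> (y \<otimes> x) = x \<otimes> y \<otimes> (inv x \<otimes> ((inv y \<otimes> y) \<otimes> x))"
      using xy by (simp only: m_assoc m_closed inv_closed c)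
    then show ?thesis using xy by simp
  qed
  ultimately show "X \<otimes>\<^bsub>(G Mod M)\<lparr>carrier := (\<lambda>a. M #> a) ` N\<rparr>\<^esub> Y =
      Y \<otimes>\<^bsub>(G Mod M)\<lparr>carrier := (\<lambda>a. M #> a) ` N\<rparr>\<^esub> X"
    using xy q.hom_mult[of x y] q.hom_mult[of y x] by simp
qed

text \<open>If the image of \<open>N\<close> in \<open>G Mod M\<close> is abelian, this is the
  preimage in \<open>N\<close> of its torsion subgroup.\<close>

definition torsion_mod :: "'a set \<Rightarrow> 'a set \<Rightarrow> 'a set" where
  "torsion_mod N M = {a \<in> N. \<exists>m::int. m \<noteq> 0 \<and> a [^] m \<in> M}"

lemma coset_int_pow_eq_one_iff:
  assumes "M \<lhd> G" "subgroup N G" "a \<in> N"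
  shows "(M #> a) [^]\<^bsub>(G Mod M)\<lparr>carrier := (\<lambda>a. M #> a) ` N\<rparr>\<^esub> (m::int) =
      \<one>\<^bsub>(G Mod M)\<lparr>carrier := (\<lambda>a. M #> a) ` N\<rparr>\<^esub> \<longleftrightarrow> a [^] m \<in> M"
proof -
  interpret M: normal M G by (rule assms(1))
  interpret q: group_hom G "G Mod M" "\<lambda>a. M #> a" by (rule M.group_hom_Mod)
  have a: "a \<in> carrier G" using assms subgroup.mem_carrier by fastforce
  have "(M #> a) [^]\<^bsub>(G Mod M)\<lparr>carrier := (\<lambda>a. M #> a) ` N\<rparr>\<^esub> m = M #> a [^] m"
    using q.H.int_pow_consistent[OF q.subgroup_img_is_subgroup[OF assms(2)], of "M #> a" m]
      q.hom_int_pow[OF a] assms(3) by auto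
  then show ?thesis using a by (simp add: rcoset_eq_self_iff[OF M.subgroup_axioms])
qed

text \<open>Products of torsion elements are torsion because \<open>N\<close> is commutative modulo
  \<open>M\<close>; conjugation commutes with powers and preserves both \<open>N\<close> and
  \<open>M\<close>.\<close>

lemma torsion_mod_normal:
  assumes M: "M \<lhd> G" and N: "N \<lhd> G" and der: "derived G N \<subseteq> M"
  shows "torsion_mod N M \<lhd> G"
proof (rule normal_invI)
  interpret M: normal M G by (rule M)
  interpret N: normal N G by (rule N)
  interpret q: group_hom G "G Mod M" "\<lambda>a. M #> a" by (rule M.group_hom_Mod)
  define A where "A = (G Mod M)\<lparr>carrier := (\<lambda>a. M #> a) ` N\<rparr>"
  interpret A: comm_group A
    unfolding A_def by (rule comm_group_factor[OF M N.subgroup_axioms der])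
  have iff: "a \<in> torsion_mod N M \<longleftrightarrow> (\<exists>m::int. m \<noteq> 0 \<and> (M #> a) [^]\<^bsub>A\<^esub> m = \<one>\<^bsub>A\<^esub>)" if "a \<in> N" for a
    using that coset_int_pow_eq_one_iff[OF M N.subgroup_axioms that] by (simp add: torsion_mod_def A_def)
  have inA: "M #> a \<in> carrier A" if "a \<in> N" for a using that by (simp add: A_def)
  have NI: "a \<in> N" if "a \<in> torsion_mod N M" for a using that by (simp add: torsion_mod_def)
  have mul: "M #> (a \<otimes> b) = (M #> a) \<otimes>\<^bsub>A\<^esub> (M #> b)" if "a \<in> N" "b \<in> N" for a b
    using that q.hom_mult by (simp add: A_def)
  show "subgroup (torsion_mod N M) G"
  proof (rule subgroupI)
    show "torsion_mod N M \<subseteq> carrier G" using NI N.subset by blast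
    have "\<one> \<in> torsion_mod N M" by (auto simp: torsion_mod_def intro!: exI[of _ 1])
    then show "torsion_mod N M \<noteq> {}" by blast
  next
    fix a assume a: "a \<in> torsion_mod N M"
    then obtain m :: int where "a \<in> N" "m \<noteq> 0" "a [^] m \<in> M" by (auto simp: torsion_mod_def)
    then have "inv a \<in> N" "inv a [^] m \<in> M" by (auto simp: int_pow_inv)
    then show "inv a \<in> torsion_mod N M" using \<open>m \<noteq> 0\<close> by (auto simp: torsion_mod_def)
  next
    fix a b assume ab: "a \<in> torsion_mod N M" "b \<in> torsion_mod N M"
    then obtain m n :: int where mn: "m \<noteq> 0" "n \<noteq> 0" "(M #> a) [^]\<^bsub>A\<^esub> m = \<one>\<^bsub>A\<^esub>" "(M #> b) [^]\<^bsub>A\<^esub> n = \<one>\<^bsub>A\<^esub>"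
      using iff NI by metis
    have "(M #> a) [^]\<^bsub>A\<^esub> (m * n) = \<one>\<^bsub>A\<^esub>" "(M #> b) [^]\<^bsub>A\<^esub> (n * m) = \<one>\<^bsub>A\<^esub>"
      using mn inA ab NI by (simp_all flip: A.int_pow_pow)
    then have "(M #> a) [^]\<^bsub>A\<^esub> (m * n) \<otimes>\<^bsub>A\<^esub> (M #> b) [^]\<^bsub>A\<^esub> (m * n) = \<one>\<^bsub>A\<^esub>"
      by (simp add: mult.commute)
    then have "(M #> (a \<otimes> b)) [^]\<^bsub>A\<^esub> (m * n) = \<one>\<^bsub>A\<^esub>"
      by (simp only: mul NI[OF ab(1)] NI[OF ab(2)] A.int_pow_distrib inA)
    then show "a \<otimes> b \<in> torsion_mod N M"
      using mn ab NI iff[of "a \<otimes> b"] by (metis N.m_closed mult_eq_0_iff)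
  qed
  fix x a assume x: "x \<in> carrier G" and a: "a \<in> torsion_mod N M"
  then obtain m :: int where m: "a \<in> N" "m \<noteq> 0" "a [^] m \<in> M" by (auto simp: torsion_mod_def)
  have "group_hom G G (\<lambda>a. x \<otimes> a \<otimes> inv x)"
  proof (unfold_locales, rule homI)
    fix a b assume ab: "a \<in> carrier G" "b \<in> carrier G"
    have "x \<otimes> a \<otimes> inv x \<otimes> (x \<otimes> b \<otimes> inv x) = x \<otimes> a \<otimes> ((inv x \<otimes> x) \<otimes> b) \<otimes> inv x"
      using x ab by (simp only: m_assoc m_closed inv_closed)
    then show "x \<otimes> (a \<otimes> b) \<otimes> inv x = x \<otimes> a \<otimes> inv x \<otimes> (x \<otimes> b \<otimes> inv x)"
      using x ab by (simp add: m_assoc)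
  qed (use x in simp)
  from group_hom.hom_int_pow[OF this N.mem_carrier[OF m(1)], of m]
  have "(x \<otimes> a \<otimes> inv x) [^] m \<in> M" using M.inv_op_closed2[OF x m(3)] by simp
  then show "x \<otimes> a \<otimes> inv x \<in> torsion_mod N M"
    using N.inv_op_closed2[OF x m(1)] m(2) by (auto simp: torsion_mod_def)
qed

text \<open>Two steps lead from \<open>N\<close> through \<open>T\<close> to the derived subgroup
  \<open>M\<close>. Modulo \<open>T\<close> the group \<open>N\<close> is torsion-free abelian;
  modulo \<open>M\<close> the group \<open>T\<close> is abelian and torsion with a cyclic series,
  hence finite.\<close>

lemma uniformly_reached_derived:
  assumes poly: "polycyclic G" and N: "N \<lhd> G" and reach: "uniformly_reached G N"
  shows "uniformly_reached G (derived G N)"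
proof -
  define M where "M = derived G N"
  define T where "T = torsion_mod N M"
  have M: "M \<lhd> G" unfolding M_def by (rule derived_is_normal[OF N])
  have sN: "subgroup N G" and sM: "subgroup M G" using N M normal_imp_subgroup by auto
  have MN: "M \<subseteq> N" unfolding M_def by (rule derived_incl[OF subset_refl sN])
  have T: "T \<lhd> G" unfolding T_def by (rule torsion_mod_normal[OF M N]) (simp add: M_def)
  have sT: "subgroup T G" using T normal_imp_subgroup by auto
  have MT: "M \<subseteq> T" using MN subgroup.mem_carrier[OF sM]
    by (auto simp: T_def torsion_mod_def intro!: exI[of _ 1])
  have TN: "T \<subseteq> N" by (auto simp: T_def torsion_mod_def)
  have "uniformly_reached G T"
  proof -
    let ?A = "(\<lambda>a. T #> a) ` N"
    interpret T: normal T G by (rule T)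
    have A: "?A \<lhd> G Mod T"
      using normal.surj_hom_normal_subgroup[OF N T.group_hom_Mod] by (simp add: carrier_FactGroup)
    have comm: "comm_group ((G Mod T)\<lparr>carrier := ?A\<rparr>)"
      using comm_group_factor[OF T sN] MT by (simp add: M_def)
    have "torsion_free ((G Mod T)\<lparr>carrier := ?A\<rparr>)"
      unfolding torsion_free_def
    proof (intro ballI allI impI)
      fix X and m :: int
      assume X: "X \<in> carrier ((G Mod T)\<lparr>carrier := ?A\<rparr>)" and m: "m \<noteq> 0"
        "X [^]\<^bsub>(G Mod T)\<lparr>carrier := ?A\<rparr>\<^esub> m = \<one>\<^bsub>(G Mod T)\<lparr>carrier := ?A\<rparr>\<^esub>"
      then obtain a where a: "a \<in> N" "X = T #> a" by auto
      have ac: "a \<in> carrier G" using subgroup.mem_carrier[OF sN a(1)] .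
      \<comment> \<open>A power of \<open>a\<close> that lies in \<open>T\<close> has itself a power
        in \<open>M\<close>, so \<open>a\<close> is already torsion modulo \<open>M\<close>.\<close>
      have "a [^] m \<in> T" using coset_int_pow_eq_one_iff[OF T sN a(1)] m(2) a(2) by blast
      then obtain n :: int where n: "n \<noteq> 0" "(a [^] m) [^] n \<in> M" by (auto simp: T_def torsion_mod_def)
      then have "a [^] (m * n) \<in> M" using ac by (simp add: int_pow_pow)
      then have "a \<in> T" using a(1) m(1) n(1) unfolding T_def torsion_mod_def
        by (auto intro!: exI[of _ "m * n"])
      then show "X = \<one>\<^bsub>(G Mod T)\<lparr>carrier := ?A\<rparr>\<^esub>"
        using a(2) rcoset_eq_self_iff[OF sT ac] by simp
    qed
    moreover obtain H k where "cyclic_series ((G Mod T)\<lparr>carrier := ?A\<rparr>) H k"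
      using cyclic_series_factor[OF poly T sN] by blast
    ultimately show ?thesis
      using uniformly_reached_step[OF T N reach]
        group.depth_bound_torsion_free[OF T.factorgroup_is_group A comm] by blast
  qed
  moreover have "depth_bound (G Mod M) ((\<lambda>a. M #> a) ` T) (card ((\<lambda>a. M #> a) ` T))"
  proof -
    let ?A = "(\<lambda>a. M #> a) ` T"
    interpret M: normal M G by (rule M)
    have "derived G T \<subseteq> M" using mono_derived[OF TN] by (simp add: M_def)
    then interpret A: comm_group "(G Mod M)\<lparr>carrier := ?A\<rparr>" by (rule comm_group_factor[OF M sT])
    obtain H k where ser: "cyclic_series ((G Mod M)\<lparr>carrier := ?A\<rparr>) H k"
      using cyclic_series_factor[OF poly M sT] by blast
    have "finite (carrier ((G Mod M)\<lparr>carrier := ?A\<rparr>))"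
    proof (rule A.finite_torsion_cyclic_series[OF ser])
      fix X assume "X \<in> carrier ((G Mod M)\<lparr>carrier := ?A\<rparr>)"
      then obtain a where a: "a \<in> T" "X = M #> a" by auto
      then obtain m :: int where "m \<noteq> 0" "a [^] m \<in> M" by (auto simp: T_def torsion_mod_def)
      then show "\<exists>m::int. m \<noteq> 0 \<and>
          X [^]\<^bsub>(G Mod M)\<lparr>carrier := ?A\<rparr>\<^esub> m = \<one>\<^bsub>(G Mod M)\<lparr>carrier := ?A\<rparr>\<^esub>"
        using coset_int_pow_eq_one_iff[OF M sT a(1)] a(2) by blast
    qed
    then have "finite ?A" by simp
    then show ?thesis by (rule group.depth_bound_finite[OF M.factorgroup_is_group])
  qed
  ultimately have "uniformly_reached G M" by (rule uniformly_reached_step[OF M T])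
  then show ?thesis by (simp add: M_def)
qed

section \<open>Descent along the derived series\<close>

lemma derived_series_normal: "(derived G ^^ j) (carrier G) \<lhd> G"
  by (induction j) (simp_all add: derived_is_normal normal_self)

text \<open>Cyclic factors are abelian, so the derived subgroup of \<open>H i\<close> lies in
  \<open>H (Suc i)\<close> and the derived series descends at least as fast as the given
  one.\<close>

lemma polycyclic_derived_series_trivial:
  assumes "polycyclic G"
  shows "\<exists>k. (derived G ^^ k) (carrier G) = {\<one>}"
proof -
  obtain H k where H: "H 0 = carrier G" "H k = {\<one>}"
      "\<forall>i<k. H (Suc i) \<lhd> (G\<lparr>carrier := H i\<rparr>) \<and> cyclic_group ((G\<lparr>carrier := H i\<rparr>) Mod H (Suc i))"
    using assms unfolding polycyclic_def by blast
  have "(derived G ^^ i) (carrier G) \<subseteq> H i" if "i \<le> k" for i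
    using that
  proof (induction i)
    case (Suc i)
    have Hi: "subgroup (H i) G" and HS: "subgroup (H (Suc i)) G"
      using polycyclic_series_subgroup[of H k] H Suc.prems by simp_all
    define K where "K = G\<lparr>carrier := H i\<rparr>"
    interpret K: group K unfolding K_def by (rule subgroup_imp_group[OF Hi])
    interpret N: normal "H (Suc i)" K using H(3) Suc.prems by (auto simp: K_def)
    interpret q: group_hom K "K Mod H (Suc i)" "\<lambda>a. H (Suc i) #>\<^bsub>K\<^esub> a" by (rule N.group_hom_Mod)
    have "cyclic_group (K Mod H (Suc i))" using H(3) Suc.prems by (auto simp: K_def)
    then interpret Q: comm_group "K Mod H (Suc i)" by (rule q.H.cyclic_imp_abelian_group)
    have "derived_set G (H i) \<subseteq> H (Suc i)"
    proof clarify
      fix x y assume xy: "x \<in> H i" "y \<in> H i"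
      then have xyK: "x \<in> carrier K" "y \<in> carrier K" by (auto simp: K_def)
      let ?q = "\<lambda>a. H (Suc i) #>\<^bsub>K\<^esub> a"
      have "?q (x \<otimes>\<^bsub>K\<^esub> y \<otimes>\<^bsub>K\<^esub> inv\<^bsub>K\<^esub> x \<otimes>\<^bsub>K\<^esub> inv\<^bsub>K\<^esub> y) = \<one>\<^bsub>K Mod H (Suc i)\<^esub>"
      proof -
        have "?q (x \<otimes>\<^bsub>K\<^esub> y \<otimes>\<^bsub>K\<^esub> inv\<^bsub>K\<^esub> x \<otimes>\<^bsub>K\<^esub> inv\<^bsub>K\<^esub> y) = ?q ((y \<otimes>\<^bsub>K\<^esub> x) \<otimes>\<^bsub>K\<^esub> inv\<^bsub>K\<^esub> x \<otimes>\<^bsub>K\<^esub> inv\<^bsub>K\<^esub> y)"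
          using xyK Q.m_comm[of "?q x" "?q y"] by (simp only: q.hom_mult K.m_closed K.inv_closed q.hom_closed)
        also have "(y \<otimes>\<^bsub>K\<^esub> x) \<otimes>\<^bsub>K\<^esub> inv\<^bsub>K\<^esub> x \<otimes>\<^bsub>K\<^esub> inv\<^bsub>K\<^esub> y = \<one>\<^bsub>K\<^esub>"
          using xyK by (simp add: K.m_assoc)
        finally show ?thesis using q.hom_one by simp
      qed
      moreover have "x \<otimes>\<^bsub>K\<^esub> y \<otimes>\<^bsub>K\<^esub> inv\<^bsub>K\<^esub> x \<otimes>\<^bsub>K\<^esub> inv\<^bsub>K\<^esub> y \<in> carrier K" using xyK by simp
      ultimately have "x \<otimes>\<^bsub>K\<^esub> y \<otimes>\<^bsub>K\<^esub> inv\<^bsub>K\<^esub> x \<otimes>\<^bsub>K\<^esub> inv\<^bsub>K\<^esub> y \<in> H (Suc i)"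
        using K.rcoset_eq_self_iff[OF N.subgroup_axioms] by (metis one_FactGroup)
      then show "x \<otimes> y \<otimes> inv x \<otimes> inv y \<in> H (Suc i)"
        using xy Hi by (simp add: K_def)
    qed
    then have "derived G (H i) \<subseteq> H (Suc i)"
      unfolding derived_def by (rule generate_subgroup_incl[OF _ HS])
    then show ?case using mono_derived[of "(derived G ^^ i) (carrier G)" "H i"] Suc by auto
  qed (simp add: H)
  from this[of k] have "(derived G ^^ k) (carrier G) \<subseteq> {\<one>}" by (simp add: H)
  moreover have "\<one> \<in> (derived G ^^ k) (carrier G)"
    using derived_series_normal normal_imp_subgroup subgroup.one_closed by blast
  ultimately show ?thesis by blast
qed

lemma polycyclic_uniformly_reached:
  assumes "polycyclic G"
  shows "uniformly_reached G {\<one>}"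
proof -
  have *: "uniformly_reached G ((derived G ^^ j) (carrier G))" for j
  proof (induction j)
    case 0
    \<comment> \<open>Polynomial maps preserve \<open>carrier G\<close>, so a single step
      suffices.\<close>
    show ?case
      using funpow_in_carrier[OF poly_maps_closed] unfolding uniformly_reached_def
      by (intro exI[of _ 1]) fastforce
  next
    case (Suc j)
    then show ?case using uniformly_reached_derived[OF assms derived_series_normal] by simp
  qed
  obtain k where "(derived G ^^ k) (carrier G) = {\<one>}"
    using polycyclic_derived_series_trivial[OF assms] by blast
  with *[of k] show ?thesis by simp
qed

end

section \<open>Iterated identities\<close>

context group
begin

lemma word_eval_cong:
  "(\<And>a. a \<in> set w \<Longrightarrow> x (fst a) = y (fst a)) \<Longrightarrow> word_eval G x w = word_eval G y w"
  by (induction w) (auto simp: word_eval_Cons)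

text \<open>Evaluation is a homomorphism on the free group, so it can be carried into the
  substituted words.\<close>

lemma word_eval_word_eval:
  assumes x: "x \<in> {..<n} \<rightarrow> carrier G" and y: "y \<in> {..<n} \<rightarrow> carrier (free_group n)"
    and w: "set w \<subseteq> {..<n} \<times> UNIV"
  shows "word_eval G x (word_eval (free_group n) y w) = word_eval G (\<lambda>i. word_eval G x (y i)) w"
proof -
  interpret F: group "free_group n" by (rule group_free_group)
  interpret h: group_hom "free_group n" G "word_eval G x"
    using word_eval_hom[OF x] by (simp add: group_hom_def group_hom_axioms_def F.is_group is_group)
  show ?thesis
    using w
  proof (induction w)
    case (Cons a w)
    have "y (fst a) \<in> carrier (free_group n)" using Cons.prems y by auto
    moreover have "word_eval (free_group n) y w \<in> carrier (free_group n)"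
      using Cons.prems by (intro F.word_eval_closed[OF y]) simp
    ultimately show ?case using Cons by (simp add: F.word_eval_Cons word_eval_Cons)
  qed (use h.hom_one in simp)
qed

lemma engel_iter_closed:
  assumes "w \<in> carrier (free_group n)" "N \<ge> 1"
  shows "engel_iter n w N \<in> carrier (free_group n)"
  using assms(2)
proof (induction N rule: dec_induct)
  case base
  then show ?case using assms engel_iter_1 by metis
next
  case (step N)
  interpret F: group "free_group n" by (rule group_free_group)
  have "gen(0 := engel_iter n w N) \<in> {..<n} \<rightarrow> carrier (free_group n)"
    using step by (auto simp: free_group_def gen_def reduced_def)
  then show ?case
    using F.word_eval_closed[of "gen(0 := engel_iter n w N)" n w] assms(1) step
    by (simp add: engel_iter_Suc free_group_def)
qed

text \<open>This turns iteration of words into iteration of a map of \<open>G\<close>. The counts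
  match because \<open>w\<close> itself is already one application of the map to
  \<open>x 0\<close>.\<close>

lemma word_eval_engel_iter:
  assumes x: "x \<in> {..<n} \<rightarrow> carrier G" and n: "n \<ge> 1" and w: "w \<in> carrier (free_group n)" and "N \<ge> 1"
  shows "word_eval G x (engel_iter n w N) = ((\<lambda>u. word_eval G (x(0 := u)) w) ^^ N) (x 0)"
  using \<open>N \<ge> 1\<close>
proof (induction N rule: dec_induct)
  case base
  show ?case by (simp add: engel_iter_def fun_upd_triv del: fun_upd_apply)
next
  case (step N)
  have sw: "set w \<subseteq> {..<n} \<times> UNIV" using w by (simp add: free_group_def)
  have "gen(0 := engel_iter n w N) \<in> {..<n} \<rightarrow> carrier (free_group n)"
    using engel_iter_closed[OF w, of N] step by (auto simp: free_group_def gen_def reduced_def)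
  then have "word_eval G x (engel_iter n w (Suc N)) =
      word_eval G (\<lambda>i. word_eval G x ((gen(0 := engel_iter n w N)) i)) w"
    using word_eval_word_eval[OF x _ sw] step by (simp add: engel_iter_Suc)
  also have "\<dots> = word_eval G (x(0 := word_eval G x (engel_iter n w N))) w"
    using sw x by (intro word_eval_cong) (auto simp: word_eval_gen Pi_iff)
  finally show ?case using step by (simp del: fun_upd_apply)
qed

lemma word_eval_poly_map:
  assumes x: "x \<in> {..<n} \<rightarrow> carrier G" and w: "set w \<subseteq> {..<n} \<times> UNIV"
  shows "(\<lambda>u. word_eval G (x(0 := u)) w) \<in> poly_maps G"
  using w
proof (induction w)
  case (Cons a w)
  \<comment> \<open>The generator of index \<open>0\<close> becomes the argument; all others are
    constants.\<close>
  have "(\<lambda>u. (x(0 := u)) (fst a)) \<in> poly_maps G"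
    using Cons.prems x by (cases "fst a = 0") (auto intro: poly_maps.intros)
  then have "(\<lambda>u. if snd a then (x(0 := u)) (fst a) else inv ((x(0 := u)) (fst a))) \<in> poly_maps G"
    by (cases "snd a") (auto dest: poly_maps.inv)
  then show ?case using Cons poly_maps.mult unfolding word_eval_Cons by fastforce
qed (simp add: poly_maps.const)

text \<open>One \<open>D\<close> serves all polynomial maps, hence all words in any number of
  variables.\<close>

lemma iterational_depth_less_top:
  assumes "uniformly_reached G {\<one>}"
  shows "iterational_depth G < \<infinity>"
proof -
  obtain D where D: "\<And>f x. f \<in> poly_maps G \<Longrightarrow> hits_one G f (carrier G) \<Longrightarrow> x \<in> carrier G \<Longrightarrow>
      \<exists>d. 1 \<le> d \<and> d \<le> D \<and> (f ^^ d) x = \<one>"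
    using assms unfolding uniformly_reached_def by auto
  have "word_depth G n w \<le> ereal (real (Suc D))"
    if n: "n \<ge> 1" and w: "w \<in> carrier (free_group n)" and id: "iterated_identity G n w" for n w
  proof -
    have "\<exists>d. 1 \<le> d \<and> d \<le> Suc D \<and> word_eval G x (engel_iter n w d) = \<one>"
      if x: "x \<in> {..<n} \<rightarrow> carrier G" for x
    proof -
      define f where "f u = word_eval G (x(0 := u)) w" for u
      have f: "f \<in> poly_maps G"
        using word_eval_poly_map[OF x] w unfolding f_def by (simp add: free_group_def)
      have "hits_one G f (carrier G)"
        unfolding hits_one_def
      proof
        fix u assume u: "u \<in> carrier G"
        \<comment> \<open>The identity is applied to the tuple with \<open>u\<close> in place of
          \<open>x 0\<close>; this change leaves the map \<open>f\<close> the same.\<close>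
        then have xu: "x(0 := u) \<in> {..<n} \<rightarrow> carrier G" using x by auto
        then obtain N where "N \<ge> 1" "word_eval G (x(0 := u)) (engel_iter n w N) = \<one>"
          using id by (auto simp: iterated_identity_def)
        then show "\<exists>N\<ge>1. (f ^^ N) u = \<one>"
          using word_eval_engel_iter[OF xu n w, of N] unfolding f_def by auto
      qed
      moreover have "x 0 \<in> carrier G" using x n by auto
      ultimately obtain d where "1 \<le> d" "d \<le> D" "(f ^^ d) (x 0) = \<one>"
        using D[OF f] by blast
      then show ?thesis
        using word_eval_engel_iter[OF x n w, of d] unfolding f_def by (intro exI[of _ d]) simp
    qed
    then show ?thesis
      unfolding word_depth_def by (intro Inf_lower CollectI exI[of _ "Suc D"]) simp
  qed
  then have "iterational_depth G \<le> ereal (real (Suc D))"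
    unfolding iterational_depth_def by (intro Sup_least) blast
  then show ?thesis by (rule le_less_trans) simp
qed

section \<open>A lower bound for the depth\<close>

lemma word_depth_ge_1: "word_depth G n w \<ge> 1"
  unfolding word_depth_def by (auto intro!: Inf_greatest)

text \<open>
  The word \<open>[x\<^sub>1, x\<^sub>2 x\<^sub>1 x\<^sub>2\<inverse>]\<close>: substituting an element of the \<open>j\<close>-th derived subgroup for \<open>x\<^sub>1\<close>
  yields an element of the next one.
\<close>

definition comm_conj_word :: word where
  "comm_conj_word =
    [(0, True), (1, True), (0, True), (1, False), (0, False), (1, True), (0, False), (1, False)]"

lemma comm_conj_word_closed: "comm_conj_word \<in> carrier (free_group 2)"
  by (auto simp: comm_conj_word_def free_group_def reduced_def inv_letter_def)

lemma iterated_identity_comm_conj_word: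
  assumes "(derived G ^^ k) (carrier G) = {\<one>}"
  shows "iterated_identity G 2 comm_conj_word"
  unfolding iterated_identity_def
proof (intro ballI exI conjI)
  fix x assume x: "x \<in> {..<(2::nat)} \<rightarrow> carrier G"
  then have x1 [simp]: "x 0 \<in> carrier G" "x 1 \<in> carrier G" by auto
  define f where "f u = word_eval G (x(0 := u)) comm_conj_word" for u
  \<comment> \<open>Both \<open>u\<close> and its conjugate by \<open>x 1\<close> lie in the normal
    subgroup \<open>N\<close>, so \<open>f u\<close> is a commutator of elements of
    \<open>N\<close>.\<close>
  have step: "f u \<in> derived G N" if N: "N \<lhd> G" "u \<in> N" for u N
  proof -
    interpret N: normal N G by (rule N(1))
    have [simp]: "u \<in> carrier G" using N.mem_carrier[OF N(2)] .
    let ?v = "x 1 \<otimes> u \<otimes> inv x 1"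
    have "u \<otimes> ?v \<otimes> inv u \<otimes> inv ?v \<in> derived G N"
      unfolding derived_def
      by (intro generate.incl UN_I[where a = u] UN_I[where a = ?v] N.inv_op_closed2 x1 N(2)) simp
    also have "u \<otimes> ?v \<otimes> inv u \<otimes> inv ?v = f u"
      using x1 by (simp add: f_def comm_conj_word_def word_eval_Cons inv_mult_group m_assoc)
    finally show ?thesis .
  qed
  have "(f ^^ j) (x 0) \<in> (derived G ^^ j) (carrier G)" for j
  proof (induction j)
    case (Suc j)
    then show ?case using step[OF derived_series_normal Suc] by simp
  qed simp
  \<comment> \<open>One step beyond \<open>k\<close> makes the count positive also when
    \<open>k = 0\<close>.\<close>
  from step[OF derived_series_normal this[of k]] have "(f ^^ Suc k) (x 0) \<in> derived G {\<one>}"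
    using assms by simp
  also have "derived G {\<one>} \<subseteq> {\<one>}" by (rule derived_incl[OF subset_refl triv_subgroup])
  finally show "word_eval G x (engel_iter 2 comm_conj_word (Suc k)) = \<one>"
    using word_eval_engel_iter[OF x _ comm_conj_word_closed, of "Suc k"]
    unfolding f_def by (simp del: fun_upd_apply)
qed simp

end

theorem corollary5p7:
  fixes G :: "('a, 'b) monoid_scheme"
  assumes "group G" and "polycyclic G"
  shows "bounded_group G"
proof -
  interpret group G by (rule assms(1))
  \<comment> \<open>A single non-trivial iterated identity gives the lower bound, each word depth
    being at least 1.\<close>
  have "iterated_identity G 2 comm_conj_word"
    using polycyclic_derived_series_trivial[OF assms(2)] iterated_identity_comm_conj_word by blast
  then have "word_depth G 2 comm_conj_word \<le> iterational_depth G"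
    unfolding iterational_depth_def using comm_conj_word_closed
    by (intro Sup_upper CollectI exI[of _ 2] exI[of _ comm_conj_word])
      (auto simp: free_group_def comm_conj_word_def)
  with word_depth_ge_1 have "1 \<le> iterational_depth G" by (rule order_trans)
  then show ?thesis
    using iterational_depth_less_top[OF polycyclic_uniformly_reached[OF assms(2)]]
    by (simp add: bounded_group_def)
qed

end
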